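(* There exists a universal constant $C\in(0,\infty)$ such that the following holds. Let $k,m,n\in\mathbb{N}$ and let $A:\mathbb{R}^m\to\mathbb{R}^n$ be a linear operator with $\mathrm{rank}(A)>k$. Then there exists a subset $\sigma\subseteq\{1,\ldots,m\}$ with $|\sigma|=k$ such that $$\|(AJ_\sigma)^{-1}\|_{S_\infty}\le C\min_{r\in\{k+1,\ldots,\mathrm{rank}(A)\}}\sqrt{\frac{mr}{(r-k)\sum_{i=r}^m s_i(A)^2}}.$$
   Context: $\mathbb{N}=\{1,2,\ldots\}$; $e_1,\ldots,e_m$ is the standard basis of $\mathbb{R}^m$. For a linear operator $A:\mathbb{R}^m\to\mathbb{R}^n$, $s_1(A)\ge s_2(A)\ge\cdots\ge s_m(A)\ge 0$ are its singular values, i.e. the eigenvalues, in decreasing order and with multiplicity, of $\sqrt{A^*A}:\mathbb{R}^m\to\mathbb{R}^m$. $\|\cdot\|_{S_\infty}$ is the operator norm with respect to Euclidean norms. For $\sigma\subseteq\{1,\ldots,m\}$, $J_\sigma:\mathbb{R}^\sigma\to\mathbb{R}^m$ is the inclusion $J_\sigma((a_j)_{j\in\sigma})=\sum_{j\in\sigma}a_je_j$. If $AJ_\sigma$ is injective, $(AJ_\sigma)^{-1}:A(\mathbb{R}^\sigma)\to\mathbb{R}^\sigma$ denotes the inverse of $AJ_\sigma$ defined on its image; if $AJ_\sigma$ is not injective, one sets $\|(AJ_\sigma)^{-1}\|_{S_\infty}=\infty$. *)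

theory Defs
  imports
    Complex_Main
    "HOL-Library.Multiset"
    "HOL-Library.Extended_Real"
    "Jordan_Normal_Form.Char_Poly"
    "Jordan_Normal_Form.DL_Rank"
begin

text \<open>
  A linear operator from R^m to R^n is given by its matrix in the standard bases, an element of
  \<^term>\<open>carrier_mat n m\<close>, so that the dimensions are ordinary natural numbers and can be quantified
  inside a formula. Over the reals the adjoint is the transpose.
\<close>

definition vnorm :: "real vec \<Rightarrow> real" where
  "vnorm x = sqrt (scalar_prod x x)"

definition psd_mat :: "real mat \<Rightarrow> bool" where
  "psd_mat B \<longleftrightarrow> B \<in> carrier_mat (dim_row B) (dim_row B) \<and> transpose_mat B = B \<and>
     (\<forall>x\<in>carrier_vec (dim_row B). 0 \<le> scalar_prod x (B *\<^sub>v x))"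

definition mat_sqrt :: "real mat \<Rightarrow> real mat" where
  "mat_sqrt G = (THE B. B \<in> carrier_mat (dim_row G) (dim_row G) \<and> psd_mat B \<and> B * B = G)"

text \<open>
  \<^term>\<open>proots\<close> lists each root of the characteristic polynomial as often as its multiplicity, so
  the list below has length \<^term>\<open>dim_col A\<close>. The singular values are numbered from 1: the
  value of \<open>singular_value A i\<close> is meaningful for i between 1 and the number of columns of A.
\<close>

definition singular_values :: "real mat \<Rightarrow> real list" where
  "singular_values A =
     rev (sorted_list_of_multiset (proots (char_poly (mat_sqrt (transpose_mat A * A)))))"

definition singular_value :: "real mat \<Rightarrow> nat \<Rightarrow> real" where
  "singular_value A i = singular_values A ! (i - 1)"

text \<open>
  The space of real families indexed by \<open>\<sigma>\<close> is identified isometrically with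
  \<^term>\<open>carrier_vec (card \<sigma>)\<close> through the increasing enumeration of \<open>\<sigma>\<close>; the inclusion then
  has as columns the standard basis vectors with index in \<open>\<sigma>\<close>. Coordinates are numbered
  from 0, i.e. \<open>\<sigma>\<close> is meant to be a subset of \<^term>\<open>{..<m}\<close>.
\<close>

definition incl_mat :: "nat \<Rightarrow> nat set \<Rightarrow> real mat" where
  "incl_mat m \<sigma> = mat_of_cols m (map (unit_vec m) (sorted_list_of_set \<sigma>))"

text \<open>
  Meant for linear maps T defined on a linear subspace W only; W then contains 0, so the supremum
  is over a nonempty set. Values of T outside W play no role.
\<close>

definition op_norm_on :: "real vec set \<Rightarrow> (real vec \<Rightarrow> real vec) \<Rightarrow> ereal" where
  "op_norm_on W T = (SUP y\<in>{y \<in> W. vnorm y \<le> 1}. ereal (vnorm (T y)))"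

definition inverse_op_norm :: "real mat \<Rightarrow> ereal" where
  "inverse_op_norm B =
     (let V = carrier_vec (dim_col B); f = (\<lambda>x. B *\<^sub>v x)
      in if inj_on f V then op_norm_on (f ` V) (inv_into V f) else \<infinity>)"

end

theory Submission
  imports Defs "Jordan_Normal_Form.Spectral_Radius"
begin

text \<open>
  Let \<open>G\<close> be the Gram matrix \<open>A\<^sup>T A\<close>, and write \<open>G\<^sub>S\<close> for the principal submatrix with
  indices in \<open>S\<close>. Starting from \<open>S = {..<m}\<close> and \<open>b = -\<beta> < 0\<close>, indices are removed one at a time,
  and each time the barrier \<open>b\<close> is raised by \<open>\<delta> = 1/\<phi>\<close>, where \<open>\<phi> = tr (G + \<beta>)\<inverse>\<close>. The invariant
  is that \<open>G\<^sub>S - b\<close> is positive definite with \<open>tr (G\<^sub>S - b)\<inverse> \<le> \<phi>\<close>. If \<open>R = (G\<^sub>S - b - \<delta>)\<inverse>\<close>, then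
  removing \<open>i\<close> changes the trace of the inverse to \<open>tr R - (R\<^sup>2)\<^sub>i\<^sub>i / R\<^sub>i\<^sub>i\<close>; some \<open>i\<close> makes this at
  most \<open>tr R - tr R\<^sup>2 / tr R\<close>, and by the invariant and the Cauchy-Schwarz inequality that is at
  most \<open>\<phi>\<close>. With \<open>k\<close> indices left, \<open>|A x|\<^sup>2 \<ge> b |x|\<^sup>2\<close> for
  \<open>b = (m - k)/\<phi> - \<beta>\<close>. As \<open>\<phi>\<close> is the sum of the \<open>1/(s\<^sub>i\<^sup>2 + \<beta>)\<close>, a suitable choice of \<open>\<beta>\<close>
  makes \<open>b\<close> at least a quarter of \<open>(r - k) (s\<^sub>r\<^sup>2 + \<dots> + s\<^sub>m\<^sup>2) / (m r)\<close>.
\<close>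

section \<open>Positive definite kernels on finite index sets\<close>

text \<open>With kernels indexed by an arbitrary set, a principal submatrix is the same function on
  a smaller set, so removing indices needs no renumbering.\<close>

definition pos_def_on :: "'a set \<Rightarrow> ('a \<Rightarrow> 'a \<Rightarrow> real) \<Rightarrow> bool" where
  "pos_def_on S Y \<longleftrightarrow> (\<forall>i\<in>S. \<forall>j\<in>S. Y i j = Y j i) \<and>
     (\<forall>x. (\<exists>i\<in>S. x i \<noteq> 0) \<longrightarrow> 0 < (\<Sum>i\<in>S. \<Sum>j\<in>S. x i * Y i j * x j))"

text \<open>A relation, since only the values on \<open>S\<close> are determined. Symmetry of
  \<open>M\<close> is built in so that, for symmetric \<open>Y\<close>, the product in the other
  order follows by transposition.\<close>

definition inverse_on :: "'a set \<Rightarrow> ('a \<Rightarrow> 'a \<Rightarrow> real) \<Rightarrow> ('a \<Rightarrow> 'a \<Rightarrow> real) \<Rightarrow> bool" where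
  "inverse_on S Y M \<longleftrightarrow> (\<forall>i\<in>S. \<forall>j\<in>S. M i j = M j i) \<and>
     (\<forall>i\<in>S. \<forall>j\<in>S. (\<Sum>k\<in>S. Y i k * M k j) = (if i = j then 1 else 0))"

definition shift :: "('a \<Rightarrow> 'a \<Rightarrow> real) \<Rightarrow> real \<Rightarrow> 'a \<Rightarrow> 'a \<Rightarrow> real" where
  "shift Y b i j = Y i j - (if i = j then b else 0)"

lemma shift_shift: "shift (shift Y b) c = shift Y (b + c)"
  by (auto simp: shift_def fun_eq_iff)

lemma sum_shift:
  assumes "finite S" "i \<in> S"
  shows "(\<Sum>j\<in>S. shift Y b i j * f j) = (\<Sum>j\<in>S. Y i j * f j) - b * f i"
proof -
  have "(\<Sum>j\<in>S. shift Y b i j * f j) = (\<Sum>j\<in>S. Y i j * f j - (if i = j then b * f j else 0))"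
    by (intro sum.cong refl) (auto simp: shift_def algebra_simps)
  then show ?thesis
    using assms by (simp add: sum_subtractf)
qed

lemma quad_shift:
  assumes "finite S"
  shows "(\<Sum>i\<in>S. \<Sum>j\<in>S. x i * shift Y b i j * x j)
    = (\<Sum>i\<in>S. \<Sum>j\<in>S. x i * Y i j * x j) - b * (\<Sum>i\<in>S. (x i)\<^sup>2)"
proof -
  have "(\<Sum>j\<in>S. x i * shift Y b i j * x j) = (\<Sum>j\<in>S. x i * Y i j * x j) - b * (x i)\<^sup>2"
    if "i \<in> S" for i
  proof -
    have "(\<Sum>j\<in>S. x i * shift Y b i j * x j) = x i * (\<Sum>j\<in>S. shift Y b i j * x j)"
      by (simp add: sum_distrib_left mult.assoc)
    then show ?thesis
      unfolding sum_shift[OF assms that]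
      by (simp add: sum_distrib_left algebra_simps power2_eq_square)
  qed
  then show ?thesis by (simp add: sum_subtractf sum_distrib_left)
qed

lemma pos_def_onD:
  assumes "pos_def_on S Y"
  shows "i \<in> S \<Longrightarrow> j \<in> S \<Longrightarrow> Y i j = Y j i"
    and "i \<in> S \<Longrightarrow> x i \<noteq> 0 \<Longrightarrow> 0 < (\<Sum>i\<in>S. \<Sum>j\<in>S. x i * Y i j * x j)"
  using assms unfolding pos_def_on_def by blast+

lemma pos_def_on_nonneg:
  assumes "pos_def_on S Y"
  shows "0 \<le> (\<Sum>i\<in>S. \<Sum>j\<in>S. x i * Y i j * x j)"
proof (cases "\<exists>i\<in>S. x i \<noteq> 0")
  case True
  then show ?thesis using pos_def_onD(2)[OF assms] by (meson less_imp_le)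
qed simp

lemma pos_def_on_subset:
  assumes "pos_def_on S Y" "T \<subseteq> S" "finite S"
  shows "pos_def_on T Y"
  unfolding pos_def_on_def
proof (intro conjI allI impI)
  show "\<forall>i\<in>T. \<forall>j\<in>T. Y i j = Y j i"
    by (intro ballI pos_def_onD(1)[OF assms(1)]) (use assms(2) in auto)
  fix x :: "'a \<Rightarrow> real"
  assume "\<exists>i\<in>T. x i \<noteq> 0"
  then obtain i where i: "i \<in> T" "x i \<noteq> 0" by blast
  define y where "y i = (if i \<in> T then x i else 0)" for i
  have "0 < (\<Sum>i\<in>S. \<Sum>j\<in>S. y i * Y i j * y j)"
    using pos_def_onD(2)[OF assms(1), of i y] i assms(2) by (auto simp: y_def)
  also have "\<dots> = (\<Sum>i\<in>T. \<Sum>j\<in>S. y i * Y i j * y j)"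
    by (rule sum.mono_neutral_right[OF assms(3,2)]) (auto simp: y_def)
  also have "\<dots> = (\<Sum>i\<in>T. \<Sum>j\<in>T. y i * Y i j * y j)"
    by (rule sum.cong[OF refl], rule sum.mono_neutral_right[OF assms(3,2)]) (auto simp: y_def)
  also have "\<dots> = (\<Sum>i\<in>T. \<Sum>j\<in>T. x i * Y i j * x j)"
    by (intro sum.cong refl) (auto simp: y_def)
  finally show "0 < \<dots>" .
qed

section \<open>Inverses of positive definite kernels\<close>

lemma inverse_onD:
  assumes "inverse_on S Y M"
  shows "i \<in> S \<Longrightarrow> j \<in> S \<Longrightarrow> M i j = M j i"
    and "i \<in> S \<Longrightarrow> j \<in> S \<Longrightarrow> (\<Sum>k\<in>S. Y i k * M k j) = (if i = j then 1 else 0)"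
  using assms unfolding inverse_on_def by blast+

lemma inverse_on_apply:
  assumes "inverse_on S Y M" "finite S" "i \<in> S"
  shows "(\<Sum>k\<in>S. Y i k * (\<Sum>j\<in>S. M k j * x j)) = x i"
proof -
  have "(\<Sum>k\<in>S. Y i k * (\<Sum>j\<in>S. M k j * x j)) = (\<Sum>j\<in>S. (\<Sum>k\<in>S. Y i k * M k j) * x j)"
    unfolding sum_distrib_left sum_distrib_right
    by (subst sum.swap) (simp add: mult.assoc)
  also have "\<dots> = (\<Sum>j\<in>S. if i = j then x j else 0)"
    by (intro sum.cong refl) (simp add: inverse_onD(2)[OF assms(1,3)])
  finally show ?thesis using assms by simp
qed

lemma inverse_on_sym:
  assumes "inverse_on S Y M" "pos_def_on S Y"
  shows "inverse_on S M Y"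
  unfolding inverse_on_def
proof (intro conjI ballI)
  fix i j assume ij: "i \<in> S" "j \<in> S"
  show "Y i j = Y j i" by (rule pos_def_onD(1)[OF assms(2) ij])
  have "(\<Sum>k\<in>S. M i k * Y k j) = (\<Sum>k\<in>S. Y j k * M k i)"
    by (intro sum.cong refl)
      (use ij inverse_onD(1)[OF assms(1)] pos_def_onD(1)[OF assms(2)] in \<open>simp add: mult.commute\<close>)
  then show "(\<Sum>k\<in>S. M i k * Y k j) = (if i = j then 1 else 0)"
    using inverse_onD(2)[OF assms(1) ij(2,1)] by auto
qed

text \<open>Put \<open>u = M x\<close>. Then \<open>Y u = x\<close>, so \<open>u\<close> is nonzero
  whenever \<open>x\<close> is, and the form of \<open>M\<close> at \<open>x\<close> equals the form
  of \<open>Y\<close> at \<open>u\<close>.\<close>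

lemma inverse_on_pos_def:
  assumes "inverse_on S Y M" "pos_def_on S Y" "finite S"
  shows "pos_def_on S M"
  unfolding pos_def_on_def
proof (intro conjI allI impI)
  show "\<forall>i\<in>S. \<forall>j\<in>S. M i j = M j i"
    using inverse_onD(1)[OF assms(1)] by blast
  fix x :: "'a \<Rightarrow> real"
  assume "\<exists>i\<in>S. x i \<noteq> 0"
  then obtain i where i: "i \<in> S" "x i \<noteq> 0" by blast
  define u where "u k = (\<Sum>j\<in>S. M k j * x j)" for k
  have Yu: "(\<Sum>k\<in>S. Y i k * u k) = x i" if "i \<in> S" for i
    unfolding u_def by (rule inverse_on_apply[OF assms(1,3) that])
  have "\<exists>k\<in>S. u k \<noteq> 0"
    using Yu[OF i(1)] i(2) by (metis (no_types, lifting) mult_zero_right sum.neutral)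
  then have "0 < (\<Sum>i\<in>S. \<Sum>j\<in>S. u i * Y i j * u j)"
    using pos_def_onD(2)[OF assms(2)] by blast
  also have "\<dots> = (\<Sum>i\<in>S. u i * x i)"
    by (intro sum.cong refl) (simp add: Yu[symmetric] sum_distrib_left mult.assoc)
  also have "\<dots> = (\<Sum>i\<in>S. \<Sum>j\<in>S. x i * M i j * x j)"
    by (simp add: u_def sum_distrib_left sum_distrib_right mult_ac)
  finally show "0 < \<dots>" .
qed

lemma pos_def_on_diag:
  assumes "pos_def_on S Y" "finite S" "i \<in> S"
  shows "0 < Y i i"
proof -
  define x :: "'a \<Rightarrow> real" where "x j = (if j = i then 1 else 0)" for j
  have "0 < (\<Sum>a\<in>S. \<Sum>b\<in>S. x a * Y a b * x b)"
    using pos_def_onD(2)[OF assms(1,3), of x] by (simp add: x_def)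
  also have "\<dots> = (\<Sum>a\<in>S. if a = i then (\<Sum>b\<in>S. if b = i then Y a b else 0) else 0)"
    by (intro sum.cong refl) (auto simp: x_def intro!: sum.cong)
  also have "\<dots> = Y i i" using assms by simp
  finally show ?thesis .
qed

text \<open>Induction on the index set. Positive definiteness makes the Schur complement positive,
  so that the block formula may divide by it.\<close>

lemma inverse_on_exists:
  assumes "finite S" "pos_def_on S Y"
  shows "\<exists>M. inverse_on S Y M"
  using assms
proof (induction S rule: finite_induct)
  case empty
  then show ?case by (simp add: inverse_on_def)
next
  case (insert a S)
  have pdS: "pos_def_on S Y"
    using pos_def_on_subset[OF insert.prems] insert.hyps by auto
  then obtain M where M: "inverse_on S Y M" using insert.IH by blast
  note symY = pos_def_onD(1)[OF insert.prems]
  \<comment> \<open>Block inversion: \<open>s\<close> is the Schur complement of the block \<open>S\<close>.\<close>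
  define u where "u i = (\<Sum>k\<in>S. M i k * Y k a)" for i
  \<comment> \<open>With this \<open>x\<close> the vector \<open>Y x\<close> vanishes on
    \<open>S\<close> and has value \<open>s\<close> at \<open>a\<close>. Hence the form of
    \<open>Y\<close> at \<open>x\<close> is \<open>s\<close>, which is therefore positive.\<close>
  define x where "x i = (if i = a then 1 else - u i)" for i
  define s where "s = (\<Sum>j\<in>insert a S. Y a j * x j)"
  have Yu: "(\<Sum>k\<in>S. Y i k * u k) = Y i a" if "i \<in> S" for i
    unfolding u_def by (rule inverse_on_apply[OF M insert.hyps(1) that])
  have xS: "(\<Sum>j\<in>S. f j * x j) = - (\<Sum>j\<in>S. f j * u j)" for f
    unfolding sum_negf[symmetric]
    by (intro sum.cong refl) (use insert.hyps in \<open>auto simp: x_def\<close>)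
  have Yx: "(\<Sum>j\<in>insert a S. Y i j * x j) = 0" if "i \<in> S" for i
    using insert.hyps Yu[OF that] xS[of "Y i"] by (simp add: x_def)
  have "0 < (\<Sum>i\<in>insert a S. \<Sum>j\<in>insert a S. x i * Y i j * x j)"
    using pos_def_onD(2)[OF insert.prems, of a x] by (simp add: x_def)
  also have "\<dots> = (\<Sum>i\<in>insert a S. x i * (\<Sum>j\<in>insert a S. Y i j * x j))"
    by (simp only: sum_distrib_left mult.assoc)
  also have "\<dots> = (\<Sum>i\<in>insert a S. if i = a then s else 0)"
    by (intro sum.cong refl) (use Yx in \<open>auto simp: s_def x_def\<close>)
  also have "\<dots> = s" using insert.hyps by simp
  finally have s: "s > 0" .
  \<comment> \<open>The new inverse is \<open>M\<close> padded by zeros plus the rank-one kernel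
    \<open>x x^T / s\<close>. Rows in \<open>S\<close> are right already, as \<open>Y x\<close>
    vanishes there; in row \<open>a\<close> the second term cancels \<open>u j\<close> and leaves 1
    on the diagonal.\<close>
  define M0 where "M0 i j = (if i \<in> S \<and> j \<in> S then M i j else 0)" for i j
  have YM0: "(\<Sum>k\<in>insert a S. Y i k * M0 k j) =
      (if j = a then 0 else \<Sum>k\<in>S. Y i k * M k j)" if "j \<in> insert a S" for i j
    using insert.hyps that by (auto simp: M0_def intro!: sum.cong)
  have "inverse_on (insert a S) Y (\<lambda>i j. M0 i j + x i * x j / s)"
    unfolding inverse_on_def
  proof (intro conjI ballI)
    fix i j assume i: "i \<in> insert a S" and j: "j \<in> insert a S"
    show "M0 i j + x i * x j / s = M0 j i + x j * x i / s"
      using inverse_onD(1)[OF M] by (auto simp: M0_def)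
    have "(\<Sum>k\<in>insert a S. Y i k * (M0 k j + x k * x j / s)) =
        (\<Sum>k\<in>insert a S. Y i k * M0 k j) + (\<Sum>k\<in>insert a S. Y i k * x k) * (x j / s)"
      by (simp only: distrib_left sum.distrib sum_distrib_right mult.assoc times_divide_eq_right
          sum_divide_distrib)
    also have "\<dots> = (if i = j then 1 else 0)"
    proof (cases "i = a")
      case False
      then show ?thesis
        using i j Yx YM0[OF j, of i] inverse_onD(2)[OF M, of i j] by auto
    next
      case True
      have "(\<Sum>k\<in>S. Y a k * M k j) = u j" if "j \<in> S"
        unfolding u_def
        by (intro sum.cong refl)
          (use that symY inverse_onD(1)[OF M] in \<open>auto simp: mult.commute\<close>)
      then show ?thesis
        unfolding True s_def[symmetric] YM0[OF j]
        using j s insert.hyps by (auto simp: x_def)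
    qed
    finally show "(\<Sum>k\<in>insert a S. Y i k * (M0 k j + x k * x j / s)) = (if i = j then 1 else 0)" .
  qed
  then show ?case by blast
qed

text \<open>Twice the difference of the two sides is the sum of all \<open>d i j\<close>, which are
  values of a positive definite form. With a single index both sides agree, so strictness rests on a
  second one.\<close>

lemma quad_less_trace:
  assumes "pos_def_on S M" "finite S" "card S \<ge> 2" "i \<in> S" "x i \<noteq> 0"
  shows "(\<Sum>i\<in>S. \<Sum>j\<in>S. x i * M i j * x j) < (\<Sum>i\<in>S. M i i) * (\<Sum>i\<in>S. (x i)\<^sup>2)"
proof -
  \<comment> \<open>\<open>d i j\<close> is the quadratic form of \<open>M\<close> at \<open>x\<^sub>j e\<^sub>i - x\<^sub>i e\<^sub>j\<close>.\<close>
  define d where "d i j = M i i * (x j)\<^sup>2 + M j j * (x i)\<^sup>2 - 2 * (x i * M i j * x j)" for i j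
  have d: "0 < d i j" if ij: "i \<in> S" "j \<in> S" "i \<noteq> j" "x i \<noteq> 0 \<or> x j \<noteq> 0" for i j
  proof -
    define z where "z k = (if k = i then x j else if k = j then - x i else 0)" for k
    have "{i, j} \<subseteq> S" using ij by blast
    have "0 < (\<Sum>k\<in>{i,j}. \<Sum>l\<in>{i,j}. z k * M k l * z l)"
    proof -
      have "\<exists>k\<in>{i, j}. z k \<noteq> 0" using ij by (auto simp: z_def)
      then show ?thesis
        using pos_def_on_subset[OF assms(1) \<open>{i, j} \<subseteq> S\<close> assms(2)]
        unfolding pos_def_on_def by blast
    qed
    also have "\<dots> = d i j"
      using ij pos_def_onD(1)[OF assms(1) ij(1,2)]
      by (simp add: z_def d_def power2_eq_square algebra_simps)
    finally show ?thesis .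
  qed
  have d0: "0 \<le> d i j" if ij: "i \<in> S" "j \<in> S" for i j
  proof (cases "i = j \<or> (x i = 0 \<and> x j = 0)")
    case True
    then show ?thesis by (auto simp: d_def power2_eq_square)
  next
    case False
    then show ?thesis using d[OF ij] by auto
  qed
  have "\<exists>j\<in>S. j \<noteq> i"
    using assms(2-4) by (metis card_le_Suc0_iff_eq not_less_eq_eq numeral_2_eq_2)
  then obtain j where j: "j \<in> S" "j \<noteq> i" by blast
  have "0 < (\<Sum>j\<in>S. d i j)"
    by (rule sum_pos2[OF assms(2) j(1)]) (use d[of i j] d0 assms(4,5) j in auto)
  then have "0 < (\<Sum>i\<in>S. \<Sum>j\<in>S. d i j)"
    by (rule sum_pos2[OF assms(2,4)]) (auto intro: sum_nonneg d0)
  also have "\<dots> = 2 * ((\<Sum>i\<in>S. M i i) * (\<Sum>i\<in>S. (x i)\<^sup>2))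
      - 2 * (\<Sum>i\<in>S. \<Sum>j\<in>S. x i * M i j * x j)"
  proof -
    have 1: "(\<Sum>i\<in>S. \<Sum>j\<in>S. M i i * (x j)\<^sup>2) = (\<Sum>i\<in>S. M i i) * (\<Sum>i\<in>S. (x i)\<^sup>2)"
      by (simp only: sum_product)
    have 2: "(\<Sum>i\<in>S. \<Sum>j\<in>S. M j j * (x i)\<^sup>2) = (\<Sum>i\<in>S. M i i) * (\<Sum>i\<in>S. (x i)\<^sup>2)"
      by (subst sum.swap) (simp only: sum_product)
    have 3: "(\<Sum>i\<in>S. \<Sum>j\<in>S. 2 * (x i * M i j * x j)) = 2 * (\<Sum>i\<in>S. \<Sum>j\<in>S. x i * M i j * x j)"
      by (simp only: sum_distrib_left)
    show ?thesis
      unfolding d_def sum_subtractf sum.distrib 1 2 3 by simp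
  qed
  finally show ?thesis by simp
qed

text \<open>The least eigenvalue of \<open>Y\<close> is the reciprocal of the largest eigenvalue of
  \<open>M\<close>, and that one is strictly below \<open>tr M\<close>, hence below
  \<open>1 / \<delta>\<close>. With a single index \<open>\<delta>\<close> could equal the
  eigenvalue.\<close>

lemma pos_def_on_shift:
  assumes "pos_def_on S Y" "inverse_on S Y M" "finite S" "card S \<ge> 2"
    and "0 < \<delta>" "\<delta> * (\<Sum>i\<in>S. M i i) \<le> 1"
  shows "pos_def_on S (shift Y \<delta>)"
  unfolding pos_def_on_def
proof (intro conjI allI impI)
  show "\<forall>i\<in>S. \<forall>j\<in>S. shift Y \<delta> i j = shift Y \<delta> j i"
    using pos_def_onD(1)[OF assms(1)] by (auto simp: shift_def)
  fix x :: "'a \<Rightarrow> real"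
  assume "\<exists>i\<in>S. x i \<noteq> 0"
  then obtain i where i: "i \<in> S" "x i \<noteq> 0" by blast
  define u where "u k = (\<Sum>j\<in>S. M k j * x j)" for k
  define X where "X = (\<Sum>i\<in>S. (x i)\<^sup>2)"
  define q where "q = (\<Sum>i\<in>S. \<Sum>j\<in>S. x i * M i j * x j)"
  have Yu: "(\<Sum>k\<in>S. Y i k * u k) = x i" if "i \<in> S" for i
    unfolding u_def by (rule inverse_on_apply[OF assms(2,3) that])
  have 1: "(\<Sum>i\<in>S. \<Sum>j\<in>S. x i * Y i j * u j) = X"
    unfolding X_def
    by (intro sum.cong refl) (simp add: Yu[symmetric] power2_eq_square sum_distrib_left mult.assoc)
  have 2: "(\<Sum>i\<in>S. \<Sum>j\<in>S. u i * Y i j * x j) = X"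
    unfolding 1[symmetric]
    by (subst sum.swap, intro sum.cong refl) (use pos_def_onD(1)[OF assms(1)] in auto)
  have "(\<Sum>j\<in>S. u i * Y i j * u j) = u i * x i" if "i \<in> S" for i
    by (simp add: Yu[OF that, symmetric] sum_distrib_left mult.assoc)
  then have 3: "(\<Sum>i\<in>S. \<Sum>j\<in>S. u i * Y i j * u j) = q"
    by (simp add: q_def u_def sum_distrib_left sum_distrib_right mult_ac)
  \<comment> \<open>Expanding the form of \<open>Y\<close> at \<open>x - \<delta> M x\<close> bounds the form at \<open>x\<close> from below.\<close>
  have "0 \<le> (\<Sum>i\<in>S. \<Sum>j\<in>S. (x i - \<delta> * u i) * Y i j * (x j - \<delta> * u j))"
    by (rule pos_def_on_nonneg[OF assms(1)])
  also have "\<dots> = (\<Sum>i\<in>S. \<Sum>j\<in>S. x i * Y i j * x j - \<delta> * (x i * Y i j * u j)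
      - \<delta> * (u i * Y i j * x j) + \<delta>\<^sup>2 * (u i * Y i j * u j))"
    by (intro sum.cong refl) (simp add: algebra_simps power2_eq_square)
  also have "\<dots> = (\<Sum>i\<in>S. \<Sum>j\<in>S. x i * Y i j * x j) - 2 * \<delta> * X + \<delta>\<^sup>2 * q"
    unfolding sum.distrib sum_subtractf sum_distrib_left[symmetric] 1 2 3 by simp
  finally have A: "2 * \<delta> * X \<le> (\<Sum>i\<in>S. \<Sum>j\<in>S. x i * Y i j * x j) + \<delta>\<^sup>2 * q" by simp
  have "q < (\<Sum>i\<in>S. M i i) * X"
    unfolding q_def X_def
    by (rule quad_less_trace[where x = x and i = i, OF inverse_on_pos_def[OF assms(2,1,3)] assms(3,4) i])
  then have "\<delta>\<^sup>2 * q < \<delta>\<^sup>2 * ((\<Sum>i\<in>S. M i i) * X)"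
    using assms(5) by simp
  also have "\<dots> = \<delta> * X * (\<delta> * (\<Sum>i\<in>S. M i i))"
    by (simp add: power2_eq_square)
  also have "\<dots> \<le> \<delta> * X * 1"
    by (rule mult_left_mono[OF assms(6)]) (use assms(5) in \<open>simp add: X_def sum_nonneg\<close>)
  finally show "0 < (\<Sum>i\<in>S. \<Sum>j\<in>S. x i * shift Y \<delta> i j * x j)"
    unfolding quad_shift[OF assms(3)] X_def[symmetric] using A by simp
qed

text \<open>Multiplying \<open>Y R = 1 + \<delta> R\<close> by \<open>M\<close> from the left gives
  this resolvent identity.\<close>

lemma shift_resolvent:
  assumes "pos_def_on S Y" "inverse_on S Y M" "inverse_on S (shift Y \<delta>) R" "finite S"
    and "i \<in> S" "j \<in> S"
  shows "\<delta> * (\<Sum>k\<in>S. M i k * R k j) = R i j - M i j"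
proof -
  have YR: "(\<Sum>k\<in>S. Y l k * R k j) = (if l = j then 1 else 0) + \<delta> * R l j" if "l \<in> S" for l
    using inverse_onD(2)[OF assms(3) that assms(6)] sum_shift[OF assms(4) that, of Y \<delta> "\<lambda>k. R k j"]
    by simp
  have "R i j = (\<Sum>l\<in>S. M i l * (\<Sum>k\<in>S. Y l k * R k j))"
    by (rule inverse_on_apply[OF inverse_on_sym[OF assms(2,1)] assms(4,5), symmetric])
  also have "\<dots> = (\<Sum>l\<in>S. (if l = j then M i l else 0) + \<delta> * (M i l * R l j))"
    by (intro sum.cong refl) (simp add: YR distrib_left)
  also have "\<dots> = M i j + \<delta> * (\<Sum>k\<in>S. M i k * R k j)"
    using assms(4,6) by (simp add: sum.distrib sum_distrib_left)
  finally show ?thesis by simp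
qed

text \<open>Block inversion read backwards. Row \<open>i\<close> of the corrected kernel vanishes,
  so sums over \<open>S - {i}\<close> may be taken over \<open>S\<close>; there the correction
  contributes nothing, because \<open>Y R\<close> is 0 at \<open>(j, i)\<close> for \<open>j\<close>
  other than \<open>i\<close>.\<close>

lemma inverse_on_remove:
  assumes "inverse_on S Y R" "finite S" "i \<in> S" "R i i \<noteq> 0"
  shows "inverse_on (S - {i}) Y (\<lambda>j l. R j l - R j i * R i l / R i i)"
  unfolding inverse_on_def
proof (intro conjI ballI)
  fix j l assume j: "j \<in> S - {i}" and l: "l \<in> S - {i}"
  show "R j l - R j i * R i l / R i i = R l j - R l i * R i j / R i i"
    using j l assms(3) inverse_onD(1)[OF assms(1)] by simp
  have "(\<Sum>k\<in>S - {i}. Y j k * (R k l - R k i * R i l / R i i)) =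
      (\<Sum>k\<in>S. Y j k * (R k l - R k i * R i l / R i i))"
    using assms by (simp add: sum.remove[of S i])
  also have "\<dots> = (\<Sum>k\<in>S. Y j k * R k l) - (\<Sum>k\<in>S. Y j k * R k i) * (R i l / R i i)"
    by (simp only: right_diff_distrib sum_subtractf sum_distrib_right mult.assoc
        times_divide_eq_right sum_divide_distrib)
  also have "\<dots> = (if j = l then 1 else 0)"
    using j l assms(3) by (simp add: inverse_onD(2)[OF assms(1)])
  finally show "(\<Sum>k\<in>S - {i}. Y j k * (R k l - R k i * R i l / R i i)) = (if j = l then 1 else 0)" .
qed

section \<open>The barrier argument\<close>

text \<open>For positive \<open>\<tau> = tr R\<close> and \<open>q = tr R^2\<close> this amounts to
  \<open>\<tau> - q / \<tau> \<le> 1 / \<delta>\<close>: a good removal makes up for the shift. The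
  resolvent identity gives the growth of the trace as \<open>\<delta> * a\<close> with
  \<open>a = tr (M R)\<close>, and a quadratic inequality bounds \<open>q\<close> from below in
  terms of \<open>a\<close>.\<close>

lemma trace_resolvent_bound:
  assumes "pos_def_on S Y" "inverse_on S Y M" "inverse_on S (shift Y \<delta>) R" "finite S"
    and "0 < \<delta>" "\<delta> * (\<Sum>i\<in>S. M i i) \<le> 1" "0 \<le> (\<Sum>i\<in>S. R i i)"
  shows "\<delta> * (\<Sum>i\<in>S. R i i)\<^sup>2 \<le> (\<Sum>i\<in>S. R i i) + \<delta> * (\<Sum>i\<in>S. \<Sum>j\<in>S. (R i j)\<^sup>2)"
proof -
  note res = shift_resolvent[OF assms(1-4)]
  note M_pd = inverse_on_pos_def[OF assms(2,1,4)]
  define p where "p l = (\<Sum>k\<in>S. M l k * R k l)" for l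
  define Q where "Q l = (\<Sum>k\<in>S. (R k l)\<^sup>2)" for l
  define t where "t = (\<Sum>i\<in>S. M i i)"
  define \<tau> where "\<tau> = (\<Sum>i\<in>S. R i i)"
  define q where "q = (\<Sum>i\<in>S. \<Sum>j\<in>S. (R i j)\<^sup>2)"
  define a where "a = (\<Sum>l\<in>S. p l)"
  have "q = (\<Sum>l\<in>S. Q l)"
    unfolding q_def Q_def by (rule sum.swap)
  have p: "\<delta> * p l = R l l - M l l" if "l \<in> S" for l
    unfolding p_def by (rule res[OF that that])
  have a: "\<delta> * a = \<tau> - t"
    unfolding a_def t_def \<tau>_def sum_distrib_left sum_subtractf[symmetric]
    by (rule sum.cong[OF refl]) (rule p)
  \<comment> \<open>The sum over \<open>l\<close> is \<open>\<delta> tr ((R - x) M (R - x)) \<ge> 0\<close>, used below for \<open>x = \<delta> a\<close>.\<close>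
  have *: "0 \<le> Q l - p l - 2 * x * (\<delta> * p l) + x\<^sup>2 * (\<delta> * M l l)" if l: "l \<in> S" for l x
  proof -
    define v where "v i = R i l - (if i = l then x else 0)" for i
    have w: "\<delta> * (\<Sum>j\<in>S. M i j * v j) = R i l - M i l - \<delta> * x * M i l" if "i \<in> S" for i
    proof -
      have "(\<Sum>j\<in>S. M i j * v j) = (\<Sum>j\<in>S. M i j * R j l - (if j = l then x * M i j else 0))"
        by (intro sum.cong refl) (auto simp: v_def algebra_simps)
      also have "\<dots> = (\<Sum>j\<in>S. M i j * R j l) - x * M i l"
        using l assms(4) by (simp add: sum_subtractf)
      finally have e: "(\<Sum>j\<in>S. M i j * v j) = (\<Sum>j\<in>S. M i j * R j l) - x * M i l" .
      show ?thesis
        unfolding e right_diff_distrib res[OF that l] by simp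
    qed
    have "0 \<le> \<delta> * (\<Sum>i\<in>S. \<Sum>j\<in>S. v i * M i j * v j)"
      using pos_def_on_nonneg[OF M_pd, of v] assms(5) by simp
    also have "\<dots> = (\<Sum>i\<in>S. v i * (\<delta> * (\<Sum>j\<in>S. M i j * v j)))"
      by (simp add: sum_distrib_left mult_ac)
    also have "\<dots> = (\<Sum>i\<in>S. v i * (R i l - M i l - \<delta> * x * M i l))"
      by (intro sum.cong refl) (simp add: w)
    also have "\<dots> = (\<Sum>i\<in>S. (R i l)\<^sup>2 - M l i * R i l - \<delta> * x * (M l i * R i l)
        - (if i = l then x * (R i l - M i l - \<delta> * x * M i l) else 0))"
      by (intro sum.cong refl)
        (use inverse_onD(1)[OF assms(2) _ l] in \<open>auto simp: v_def algebra_simps power2_eq_square\<close>)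
    also have "\<dots> = Q l - p l - \<delta> * x * p l - x * (R l l - M l l - \<delta> * x * M l l)"
      using l assms(4) by (simp add: Q_def p_def sum_subtractf sum_distrib_left)
    finally show ?thesis
      unfolding p[OF l, symmetric] by (simp add: algebra_simps power2_eq_square)
  qed
  have "0 \<le> (\<Sum>l\<in>S. Q l - p l - 2 * x * (\<delta> * p l) + x\<^sup>2 * (\<delta> * M l l))" for x
    by (intro sum_nonneg *)
  also have "(\<Sum>l\<in>S. Q l - p l - 2 * x * (\<delta> * p l) + x\<^sup>2 * (\<delta> * M l l)) =
      q - a - 2 * x * (\<delta> * a) + x\<^sup>2 * (\<delta> * t)" for x
    unfolding sum.distrib sum_subtractf a_def t_def \<open>q = (\<Sum>l\<in>S. Q l)\<close>
    by (simp only: sum_distrib_left)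
  \<comment> \<open>For \<open>x = \<delta> * a\<close> the last two terms add up to at most
    \<open>- (\<delta> * a)\<^sup>2\<close>, because \<open>\<delta> * t \<le> 1\<close>.\<close>
  finally have "0 \<le> q - a - 2 * (\<delta> * a)\<^sup>2 + (\<delta> * a)\<^sup>2 * (\<delta> * t)"
    by (metis (no_types) mult.assoc power2_eq_square)
  moreover have "(\<delta> * a)\<^sup>2 * (\<delta> * t) \<le> (\<delta> * a)\<^sup>2 * 1"
    by (rule mult_left_mono) (use assms(6) in \<open>simp_all add: t_def\<close>)
  ultimately have q: "a + (\<delta> * a)\<^sup>2 \<le> q" by simp
  have \<tau>: "\<delta> * \<tau> \<le> 1 + \<delta> * (\<delta> * a)"
  proof -
    have "\<tau> = t + \<delta> * a" using a by simp
    then show ?thesis using assms(6) by (simp add: t_def distrib_left)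
  qed
  have "q \<ge> 0" by (simp add: q_def sum_nonneg)
  \<comment> \<open>Of \<open>R\<close> only the sign of its trace is assumed, so the sign of
    \<open>a\<close> is treated by cases. A negative \<open>a\<close> gives
    \<open>\<delta> * \<tau> \<le> 1\<close>, and the left side is then at most 0.\<close>
  have "\<tau> * (\<delta> * \<tau> - 1) \<le> \<delta> * q"
  proof (cases "a \<ge> 0")
    case True
    have "\<tau> * (\<delta> * \<tau> - 1) \<le> \<tau> * (\<delta> * (\<delta> * a))"
      by (rule mult_left_mono) (use \<tau> assms(7) in \<open>simp_all add: \<tau>_def\<close>)
    also have "\<dots> = (\<delta> * \<tau>) * (\<delta> * a)" by simp
    also have "\<dots> \<le> (1 + \<delta> * (\<delta> * a)) * (\<delta> * a)"
      by (rule mult_right_mono[OF \<tau>]) (use True assms(5) in simp)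
    also have "\<dots> = \<delta> * (a + (\<delta> * a)\<^sup>2)" by (simp add: algebra_simps power2_eq_square)
    also have "\<dots> \<le> \<delta> * q" using q assms(5) by simp
    finally show ?thesis .
  next
    case False
    then have "\<delta> * (\<delta> * a) \<le> 0" using assms(5) by (simp add: mult_le_0_iff)
    then have "\<tau> * (\<delta> * \<tau> - 1) \<le> 0"
      using \<tau> assms(7) by (intro mult_nonneg_nonpos) (simp_all add: \<tau>_def)
    then show ?thesis using \<open>q \<ge> 0\<close> assms(5) by (meson dual_order.trans less_imp_le mult_nonneg_nonneg)
  qed
  then show ?thesis
    unfolding \<tau>_def[symmetric] q_def[symmetric] by (simp add: algebra_simps power2_eq_square)
qed

text \<open>The shift is made first, on all of \<open>S\<close>; the removal then brings the trace
  of the inverse back to at most \<open>1 / \<delta>\<close>, so the hypotheses on kernel and trace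
  recur with the same \<open>\<delta>\<close>.\<close>

lemma barrier_step:
  assumes "pos_def_on S Y" "inverse_on S Y M" "finite S" "card S \<ge> 2"
    and "0 < \<delta>" "\<delta> * (\<Sum>i\<in>S. M i i) \<le> 1"
  shows "\<exists>i\<in>S. \<exists>R. pos_def_on (S - {i}) (shift Y \<delta>) \<and> inverse_on (S - {i}) (shift Y \<delta>) R \<and>
    \<delta> * (\<Sum>j\<in>S - {i}. R j j) \<le> 1"
proof -
  have pd: "pos_def_on S (shift Y \<delta>)" by (rule pos_def_on_shift[OF assms])
  then obtain R where R: "inverse_on S (shift Y \<delta>) R"
    using inverse_on_exists[OF assms(3)] by blast
  have R_diag: "0 < R i i" if "i \<in> S" for i
    by (rule pos_def_on_diag[OF inverse_on_pos_def[OF R pd assms(3)] assms(3) that])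
  define \<tau> where "\<tau> = (\<Sum>i\<in>S. R i i)"
  define Q where "Q i = (\<Sum>j\<in>S. (R i j)\<^sup>2)" for i
  define q where "q = (\<Sum>i\<in>S. Q i)"
  have "S \<noteq> {}" using assms(4) by auto
  have "0 < \<tau>" unfolding \<tau>_def by (rule sum_pos[OF assms(3) \<open>S \<noteq> {}\<close> R_diag])
  \<comment> \<open>Averaging with weights \<open>R i i\<close>: the \<open>Q i\<close> sum to
    \<open>q\<close> and the \<open>R i i\<close> to \<open>\<tau>\<close>, so
    \<open>Q i / R i i\<close> cannot be below \<open>q / \<tau>\<close> everywhere.\<close>
  have "\<exists>i\<in>S. q * R i i \<le> Q i * \<tau>"
  proof (rule ccontr)
    assume "\<not> ?thesis"
    then have "(\<Sum>i\<in>S. Q i * \<tau>) < (\<Sum>i\<in>S. q * R i i)"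
      by (intro sum_strict_mono[OF assms(3) \<open>S \<noteq> {}\<close>]) force
    then show False
      by (simp add: sum_distrib_left[symmetric] sum_distrib_right[symmetric] \<tau>_def q_def)
  qed
  then obtain i where i: "i \<in> S" "q * R i i \<le> Q i * \<tau>" by blast
  define R' where "R' j l = R j l - R j i * R i l / R i i" for j l
  have inv: "inverse_on (S - {i}) (shift Y \<delta>) R'"
    unfolding R'_def by (rule inverse_on_remove[OF R assms(3) i(1)]) (use R_diag[OF i(1)] in simp)
  \<comment> \<open>The diagonal entry of \<open>R'\<close> at the removed index is 0, so it may
    join the sum.\<close>
  have "(\<Sum>j\<in>S - {i}. R' j j) = (\<Sum>j\<in>S. R' j j)"
    using assms(3) i(1) R_diag[OF i(1)] by (simp add: sum.remove[of S i] R'_def)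
  also have "\<dots> = (\<Sum>j\<in>S. R j j - (R i j)\<^sup>2 / R i i)"
    by (intro sum.cong refl)
      (use inverse_onD(1)[OF R _ i(1)] in \<open>simp add: R'_def power2_eq_square\<close>)
  also have "\<dots> = \<tau> - Q i / R i i"
    by (simp add: sum_subtractf \<tau>_def Q_def sum_divide_distrib)
  finally have tr: "(\<Sum>j\<in>S - {i}. R' j j) = \<tau> - Q i / R i i" .
  have "q / \<tau> \<le> Q i / R i i"
    using i(2) R_diag[OF i(1)] \<open>0 < \<tau>\<close> by (simp add: divide_simps)
  then have "\<delta> * (\<tau> - Q i / R i i) \<le> \<delta> * (\<tau> - q / \<tau>)" using assms(5) by simp
  also have "\<dots> = (\<delta> * \<tau>\<^sup>2 - \<delta> * q) / \<tau>"
    using \<open>0 < \<tau>\<close> by (simp add: field_simps power2_eq_square)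
  also have "\<dots> \<le> 1"
    using trace_resolvent_bound[OF assms(1,2) R assms(3,5,6)] \<open>0 < \<tau>\<close>
    by (simp add: divide_simps \<tau>_def[symmetric] q_def Q_def)
  finally have "\<delta> * (\<Sum>j\<in>S - {i}. R' j j) \<le> 1" unfolding tr .
  moreover have "pos_def_on (S - {i}) (shift Y \<delta>)"
    by (rule pos_def_on_subset[OF pd _ assms(3)]) simp
  ultimately show ?thesis using inv i(1) by blast
qed

text \<open>Every round restores the trace bound, so one \<open>\<delta>\<close> serves in all
  \<open>card S - k\<close> rounds and the shifts add up. As \<open>1 \<le> k\<close>, each round
  starts from at least two indices, as \<open>barrier_step\<close> demands.\<close>

lemma barrier_subset:
  assumes "finite S" "pos_def_on S Y" "inverse_on S Y M" "0 < \<delta>" "\<delta> * (\<Sum>i\<in>S. M i i) \<le> 1"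
    and "1 \<le> k" "k \<le> card S"
  shows "\<exists>T\<subseteq>S. card T = k \<and> pos_def_on T (shift Y (real (card S - k) * \<delta>))"
  using assms
proof (induction "card S - k" arbitrary: S Y M)
  case 0
  then have "shift Y (real (card S - k) * \<delta>) = Y" by (simp add: shift_def fun_eq_iff)
  then show ?case using 0 by (intro exI[of _ S]) auto
next
  case (Suc d)
  have "card S \<ge> 2" using Suc.hyps(2) Suc.prems(6) by linarith
  then obtain i R where i: "i \<in> S" and R: "pos_def_on (S - {i}) (shift Y \<delta>)"
    "inverse_on (S - {i}) (shift Y \<delta>) R" "\<delta> * (\<Sum>j\<in>S - {i}. R j j) \<le> 1"
    using barrier_step[OF Suc.prems(2,3,1) _ Suc.prems(4,5)] by blast
  have c: "card (S - {i}) = card S - 1" using i Suc.prems(1) by simp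
  have "\<exists>T\<subseteq>S - {i}. card T = k \<and>
      pos_def_on T (shift (shift Y \<delta>) (real (card (S - {i}) - k) * \<delta>))"
    by (rule Suc.hyps(1)[OF _ _ R(1,2) Suc.prems(4) R(3) Suc.prems(6)])
      (use c Suc.hyps(2) Suc.prems(1) in auto)
  moreover have "\<delta> + real (card (S - {i}) - k) * \<delta> = real (card S - k) * \<delta>"
  proof -
    have "card S - k = Suc (card (S - {i}) - k)" using c Suc.hyps(2) by linarith
    then show ?thesis by (simp add: algebra_simps)
  qed
  ultimately show ?case unfolding shift_shift by auto
qed

text \<open>The first \<open>r - 1\<close> values are lowered to the \<open>r\<close>-th largest
  value \<open>L\<close>, and the convex function \<open>1 / (u + \<beta>)\<close> is replaced by
  its chord over \<open>[0, L]\<close>. The bound on the trace then involves the values only through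
  \<open>L\<close> and their capped total, which makes a good \<open>\<beta>\<close>
  explicit.\<close>

lemma barrier_value:
  fixes y :: "nat \<Rightarrow> real"
  assumes dec: "\<And>i j. i \<le> j \<Longrightarrow> j < m \<Longrightarrow> y j \<le> y i" and nonneg: "\<And>j. j < m \<Longrightarrow> 0 \<le> y j"
    and k: "k < r" and r: "r \<le> m" and pos: "0 < y (r - 1)"
  shows "\<exists>\<beta>>0. (real r - real k) * (\<Sum>i\<in>{r - 1..<m}. y i) / (4 * real m * real r)
    \<le> (real m - real k) / (\<Sum>i<m. 1 / (y i + \<beta>)) - \<beta>"
proof -
  \<comment> \<open>\<open>y\<close> is numbered from 0, so this is the \<open>r\<close>-th largest
    value. With \<open>t\<close> and \<open>N\<close> as below, \<open>N * L\<close> is the sum of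
    all values capped at \<open>L\<close>, and \<open>r \<le> N \<le> m\<close>.\<close>
  define L where "L = y (r - 1)"
  define T where "T = (\<Sum>i\<in>{r - 1..<m}. y i)"
  define t where "t = T / L"
  define N where "N = real r - 1 + t"
  \<comment> \<open>Chosen so that \<open>N L / (L + \<beta>)\<close> is the midpoint of \<open>k\<close> and \<open>N\<close>.\<close>
  define \<beta> where "\<beta> = L * (N - k) / (N + k)"
  define \<phi> where "\<phi> = (\<Sum>i<m. 1 / (y i + \<beta>))"
  have L: "0 < L" using pos by (simp add: L_def)
  have T: "T = L * t" using L by (simp add: t_def)
  have "L \<le> T"
    unfolding L_def T_def by (rule member_le_sum) (use k r nonneg in auto)
  then have t: "1 \<le> t" using L by (simp add: t_def)
  have N_r: "real r \<le> N" using t by (simp add: N_def)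
  have "T \<le> (\<Sum>i\<in>{r - 1..<m}. L)"
    unfolding T_def L_def by (intro sum_mono dec) auto
  also have "\<dots> = L * (real m - real r + 1)" using k r by (simp add: of_nat_diff algebra_simps)
  finally have "t \<le> real m - real r + 1" using L by (simp add: T)
  then have N_m: "N \<le> real m" by (simp add: N_def)
  have N_k: "real k < N" using k N_r by linarith
  then have N0: "0 < N" by linarith
  have \<beta>: "0 < \<beta>" using L N_k by (simp add: \<beta>_def)
  have Lb: "L + \<beta> = L * (2 * N) / (N + k)"
    using N0 by (simp add: \<beta>_def field_simps)
  \<comment> \<open>The chord of \<open>1 / (u + \<beta>)\<close> between \<open>u = 0\<close> and
    \<open>u = L\<close>. It is applied with \<open>u = L\<close> to the first \<open>r - 1\<close>
    values and with \<open>u = z\<close> to the others.\<close>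
  have frac: "1 / (z + \<beta>) \<le> 1 / \<beta> - u / (\<beta> * (L + \<beta>))" if "0 \<le> u" "u \<le> z" "u \<le> L" for z u
  proof -
    have "1 / (z + \<beta>) \<le> 1 / (u + \<beta>)" using that \<beta> by (simp add: frac_le)
    also have "\<dots> = 1 / \<beta> - u / (\<beta> * (u + \<beta>))"
    proof -
      have "u + \<beta> \<noteq> 0" "\<beta> \<noteq> 0" using that \<beta> by auto
      then show ?thesis by (simp add: divide_simps)
    qed
    also have "\<dots> \<le> 1 / \<beta> - u / (\<beta> * (L + \<beta>))"
      using that \<beta> L by (simp add: divide_left_mono mult_left_mono)
    finally show ?thesis .
  qed
  have split: "{..<m} = {..<r - 1} \<union> {r - 1..<m}" using r by auto
  have "\<phi> = (\<Sum>i<r - 1. 1 / (y i + \<beta>)) + (\<Sum>i\<in>{r - 1..<m}. 1 / (y i + \<beta>))"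
    unfolding \<phi>_def split by (rule sum.union_disjoint) auto
  also have "\<dots> \<le> (\<Sum>i<r - 1. 1 / \<beta> - L / (\<beta> * (L + \<beta>)))
      + (\<Sum>i\<in>{r - 1..<m}. 1 / \<beta> - y i / (\<beta> * (L + \<beta>)))"
    by (intro add_mono sum_mono frac) (use L k r dec nonneg in \<open>auto simp: L_def\<close>)
  also have "\<dots> = m / \<beta> - (N * L) / (\<beta> * (L + \<beta>))"
  proof -
    have m_r: "real (r - 1) = real r - 1" "real (m - (r - 1)) = real m - real r + 1"
      using k r by (simp_all add: of_nat_diff)
    have "N * L = (real r - 1) * L + T" by (simp add: N_def T algebra_simps)
    moreover define d where "d = \<beta> * (L + \<beta>)"
    ultimately have "N * L / d = (real r - 1) * (L / d) + T / d"
      by (simp add: add_divide_distrib)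
    then show ?thesis
      unfolding d_def[symmetric] T_def using m_r
      by (simp add: sum_subtractf sum_divide_distrib[symmetric] algebra_simps)
  qed
  also have "\<dots> = (m - (N + k) / 2) / \<beta>"
  proof -
    have "(N * L) / (L + \<beta>) = (N + k) / 2" unfolding Lb using L N0 by simp
    then have "(N * L) / (\<beta> * (L + \<beta>)) = (N + k) / 2 / \<beta>"
      by (metis divide_divide_eq_left mult.commute)
    then show ?thesis by (simp add: diff_divide_distrib)
  qed
  finally have \<phi>_le: "\<phi> \<le> (m - (N + k) / 2) / \<beta>" .
  define D where "D = m - (N + k) / 2"
  have D: "0 < D" using N_m N_k by (simp add: D_def)
  have D_m: "D \<le> m" using N0 by (simp add: D_def)
  have "0 < \<phi>"
    unfolding \<phi>_def by (rule sum_pos) (use k r nonneg \<beta> in \<open>auto simp: add_nonneg_pos lessThan_empty_iff\<close>)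
  \<comment> \<open>Since \<open>T = L * t\<close>, two facts suffice: \<open>t \<le> N - k\<close>,
    from \<open>k + 1 \<le> r\<close>, and \<open>(r - k) / r \<le> (N - k) / N\<close>, from
    \<open>r \<le> N\<close>.\<close>
  have "(real r - real k) * T / (4 * real m * real r) \<le> L * (N - k)\<^sup>2 / (4 * m * N)"
  proof -
    have le: "(real r - real k) * N \<le> (N - k) * r"
      using mult_left_mono[OF N_r, of "real k"] by (simp add: algebra_simps)
    have "t * ((real r - real k) * N) \<le> (N - k) * ((N - k) * r)"
    proof (rule mult_mono)
      show "t \<le> N - k" using k by (simp add: N_def)
    qed (use le k N0 N_k in simp_all)
    then have "L * (t * ((real r - real k) * N)) \<le> L * ((N - k) * ((N - k) * r))"
      using L by (intro mult_left_mono) auto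
    then have "L * (t * ((real r - real k) * N)) / (4 * m * r * N) \<le>
        L * ((N - k) * ((N - k) * r)) / (4 * m * r * N)"
      by (rule divide_right_mono) (use N0 in simp)
    then show ?thesis
      using k N0 by (simp add: T power2_eq_square mult_ac)
  qed
  also have "\<dots> \<le> L * (N - k)\<^sup>2 / (2 * m * (N + k))"
    using L N_k k r N0 by (intro divide_left_mono) (auto simp: mult_left_mono)
  also have "\<dots> = \<beta> * ((N - k) / 2) / m"
    using N0 by (simp add: \<beta>_def field_simps power2_eq_square)
  also have "\<dots> \<le> \<beta> * ((N - k) / 2) / D"
    using \<beta> N_k D D_m by (intro divide_left_mono) auto
  \<comment> \<open>By the definition of \<open>D\<close>,
    \<open>m - k - D = (N - k) / 2\<close>.\<close>
  also have "\<dots> = (real m - k) / (D / \<beta>) - \<beta>"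
    using D \<beta> by (simp add: field_simps D_def)
  also have "\<dots> \<le> (real m - k) / \<phi> - \<beta>"
    using \<phi>_le \<open>0 < \<phi>\<close> D \<beta> k r by (intro diff_mono divide_left_mono) (auto simp: D_def)
  finally show ?thesis using \<beta> unfolding T_def \<phi>_def by blast
qed

section \<open>Spectral theorem and square roots of real matrices\<close>

lemma scalar_prod_eq_0_real:
  fixes v :: "real vec"
  assumes "v \<bullet> v = 0"
  shows "v = 0\<^sub>v (dim_vec v)"
proof (rule eq_vecI)
  fix i assume i: "i < dim_vec (0\<^sub>v (dim_vec v))"
  have "(\<Sum>i = 0..<dim_vec v. v $ i * v $ i) = 0"
    using assms by (simp add: scalar_prod_def)
  then have "v $ i * v $ i = 0"
    by (subst (asm) sum_nonneg_eq_0_iff) (use i in auto)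
  then show "v $ i = 0\<^sub>v (dim_vec v) $ i" using i by simp
qed simp

lemma scalar_prod_self_nonneg: "0 \<le> v \<bullet> (v :: real vec)"
  by (auto simp: scalar_prod_def intro: sum_nonneg)

lemma scalar_prod_self_pos:
  fixes v :: "real vec"
  assumes "v \<in> carrier_vec n" "v \<noteq> 0\<^sub>v n"
  shows "0 < v \<bullet> v"
  using scalar_prod_eq_0_real[of v] scalar_prod_self_nonneg[of v] assms
  by (cases "v \<bullet> v = 0") auto

text \<open>The Hermitian form of \<open>B\<close> at an eigenvector, evaluated in two ways, gives
  \<open>e * N = cnj e * N\<close>, where \<open>N\<close> is the squared norm of the eigenvector
  and so is nonzero.\<close>

lemma symmetric_complex_eigenvalue_real:
  fixes B :: "real mat"
  assumes B: "B \<in> carrier_mat n n" and sym: "transpose_mat B = B"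
    and e: "eigenvalue (map_mat complex_of_real B) e"
  shows "e = complex_of_real (Re e)"
proof -
  obtain w where w: "w \<in> carrier_vec n" "w \<noteq> 0\<^sub>v n" "map_mat complex_of_real B *\<^sub>v w = e \<cdot>\<^sub>v w"
    using e B unfolding eigenvalue_def eigenvector_def by auto
  have Bij: "B $$ (i, j) = B $$ (j, i)" if "i < n" "j < n" for i j
    using that B sym by (metis carrier_matD index_transpose_mat(1))
  have Bw: "(\<Sum>j<n. of_real (B $$ (i, j)) * w $ j) = e * w $ i" if i: "i < n" for i
  proof -
    have "(\<Sum>j<n. of_real (B $$ (i, j)) * w $ j) = (map_mat complex_of_real B *\<^sub>v w) $ i"
      using i B w(1) by (simp add: scalar_prod_def lessThan_atLeast0)
    then show ?thesis using w(1) i unfolding w(3) by simp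
  qed
  have cBw: "(\<Sum>j<n. of_real (B $$ (i, j)) * cnj (w $ j)) = cnj e * cnj (w $ i)" if "i < n" for i
    using arg_cong[OF Bw[OF that], of cnj] by simp
  define N where "N = (\<Sum>i<n. w $ i * cnj (w $ i))"
  have "e * N = (\<Sum>i<n. (\<Sum>j<n. of_real (B $$ (i, j)) * w $ j) * cnj (w $ i))"
    unfolding N_def sum_distrib_left by (intro sum.cong refl) (simp add: Bw)
  also have "\<dots> = (\<Sum>i<n. \<Sum>j<n. of_real (B $$ (i, j)) * w $ j * cnj (w $ i))"
    by (simp only: sum_distrib_right)
  also have "\<dots> = (\<Sum>j<n. \<Sum>i<n. of_real (B $$ (i, j)) * w $ j * cnj (w $ i))"
    by (rule sum.swap)
  also have "\<dots> = (\<Sum>j<n. w $ j * (\<Sum>i<n. of_real (B $$ (j, i)) * cnj (w $ i)))"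
    unfolding sum_distrib_left by (intro sum.cong refl) (simp add: Bij mult_ac)
  also have "\<dots> = (\<Sum>j<n. cnj e * (w $ j * cnj (w $ j)))"
    by (intro sum.cong refl) (simp add: cBw)
  also have "\<dots> = cnj e * N" by (simp only: N_def sum_distrib_left)
  finally have eN: "e * N = cnj e * N" .
  have "\<exists>i<n. w $ i \<noteq> 0" using w(1,2) by (auto simp: vec_eq_iff)
  then obtain i where i: "i < n" "w $ i \<noteq> 0" by blast
  have "N = of_real (\<Sum>i<n. (cmod (w $ i))\<^sup>2)"
    unfolding N_def of_real_sum by (intro sum.cong refl) (simp only: complex_norm_square)
  moreover have "0 < (\<Sum>i<n. (cmod (w $ i))\<^sup>2)"
    by (rule sum_pos2[of _ i]) (use i in auto)
  ultimately have "N \<noteq> 0" by (metis less_irrefl of_real_eq_0_iff)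
  then have "e = cnj e" using eN by simp
  then show ?thesis by (metis Reals_cnj_iff of_real_Re)
qed

text \<open>Over the complex numbers an eigenvalue exists. It is real by symmetry, hence a root of
  the real characteristic polynomial, and so it has a real eigenvector, which is then
  normalised.\<close>

lemma symmetric_unit_eigenvector:
  fixes B :: "real mat"
  assumes B: "B \<in> carrier_mat n n" and sym: "transpose_mat B = B" and n: "0 < n"
  shows "\<exists>v e. v \<in> carrier_vec n \<and> v \<bullet> v = 1 \<and> B *\<^sub>v v = e \<cdot>\<^sub>v v"
proof -
  let ?C = "map_mat complex_of_real B"
  have C: "?C \<in> carrier_mat n n" using B by simp
  obtain e where e: "eigenvalue ?C e"
    using spectrum_non_empty[OF C n] unfolding spectrum_def by auto
  define r where "r = Re e"
  have r: "e = complex_of_real r"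
    unfolding r_def by (rule symmetric_complex_eigenvalue_real[OF B sym e])
  have "poly (map_poly complex_of_real (char_poly B)) (complex_of_real r) = 0"
    using e unfolding eigenvalue_root_char_poly[OF C] r of_real_hom.char_poly_hom[OF B] .
  then have "poly (char_poly B) r = 0" by simp
  then have "eigenvalue B r" unfolding eigenvalue_root_char_poly[OF B] .
  then obtain w where w: "w \<in> carrier_vec n" "w \<noteq> 0\<^sub>v n" "B *\<^sub>v w = r \<cdot>\<^sub>v w"
    using B unfolding eigenvalue_def eigenvector_def by auto
  define c where "c = 1 / sqrt (w \<bullet> w)"
  have ww: "0 < w \<bullet> w" by (rule scalar_prod_self_pos[OF w(1,2)])
  have "(c \<cdot>\<^sub>v w) \<bullet> (c \<cdot>\<^sub>v w) = c * c * (w \<bullet> w)" using w(1) by simp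
  also have "\<dots> = 1" using ww by (simp add: c_def)
  finally have "(c \<cdot>\<^sub>v w) \<bullet> (c \<cdot>\<^sub>v w) = 1" .
  moreover have "B *\<^sub>v (c \<cdot>\<^sub>v w) = r \<cdot>\<^sub>v (c \<cdot>\<^sub>v w)"
    unfolding mult_mat_vec[OF B w(1)] w(3) by (simp add: smult_smult_assoc mult.commute)
  ultimately show ?thesis using w(1) by (intro exI[of _ "c \<cdot>\<^sub>v w"] exI[of _ r]) auto
qed

text \<open>The reflection that exchanges \<open>v\<close> with the first basis vector:
  \<open>H = 1 - c w w^T\<close>, where \<open>w\<close> is the difference of the two and
  \<open>c = 2 / |w|^2 = 1 / (1 - v $ 0)\<close>.\<close>

lemma householder:
  fixes v :: "real vec"
  assumes v: "v \<in> carrier_vec n" and vv: "v \<bullet> v = 1" and n: "0 < n"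
  shows "\<exists>H \<in> carrier_mat n n. transpose_mat H = H \<and> H * H = 1\<^sub>m n \<and> col H 0 = v"
proof -
  define w where "w i = v $ i - (if i = 0 then 1 else 0)" for i
  define c where "c = 1 / (1 - v $ 0)"
  have S: "(\<Sum>i<n. (v $ i)\<^sup>2) = 1"
    using vv v by (simp add: scalar_prod_def power2_eq_square lessThan_atLeast0)
  have "(\<Sum>i<n. (w i)\<^sup>2) = (\<Sum>i<n. (v $ i)\<^sup>2 + (if i = 0 then 1 - 2 * v $ 0 else 0))"
    by (intro sum.cong refl) (auto simp: w_def power2_eq_square algebra_simps)
  also have "\<dots> = 2 - 2 * v $ 0" using S n by (simp add: sum.distrib)
  finally have ww: "(\<Sum>i<n. (w i)\<^sup>2) = 2 - 2 * v $ 0" .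
  show ?thesis
  proof (cases "v $ 0 = 1")
    \<comment> \<open>Here \<open>w = 0\<close> and the reflection degenerates; \<open>v\<close> is
      the first basis vector and the identity will do.\<close>
    case True
    then have "(\<Sum>i<n. (w i)\<^sup>2) = 0" using ww by simp
    then have "w i = 0" if "i < n" for i
      by (subst (asm) sum_nonneg_eq_0_iff) (use that in auto)
    then have "v = unit_vec n 0"
      using v by (intro eq_vecI) (auto simp: w_def split: if_splits)
    then show ?thesis using n by (intro bexI[of _ "1\<^sub>m n"]) auto
  next
    case False
    define H where "H = mat n n (\<lambda>(i, j). (if i = j then 1 else 0) - c * w i * w j)"
    have H: "H \<in> carrier_mat n n" by (simp add: H_def)
    have c: "c * (2 - 2 * v $ 0) = 2" using False by (simp add: c_def field_simps)
    have "H * H = 1\<^sub>m n"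
    proof (rule eq_matI)
      fix i j assume "i < dim_row (1\<^sub>m n)" "j < dim_col (1\<^sub>m n)"
      then have ij: "i < n" "j < n" by auto
      have "(H * H) $$ (i, j) = (\<Sum>k<n. ((if i = k then 1 else 0) - c * w i * w k)
          * ((if k = j then 1 else 0) - c * w k * w j))"
        using ij by (simp add: H_def scalar_prod_def lessThan_atLeast0)
      also have "\<dots> = (\<Sum>k<n. (if i = k then (if i = j then 1 else 0) - c * w i * w j else 0)
          - (if k = j then c * w i * w j else 0) + c * w i * w j * (c * (w k)\<^sup>2))"
        by (intro sum.cong refl) (auto simp: algebra_simps power2_eq_square)
      also have "\<dots> = (if i = j then 1 else 0) - c * w i * w j - c * w i * w j
          + c * w i * w j * (c * (\<Sum>k<n. (w k)\<^sup>2))"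
        using ij by (simp add: sum.distrib sum_subtractf sum_distrib_left)
      also have "\<dots> = (if i = j then 1 else 0)" unfolding ww c by simp
      finally show "(H * H) $$ (i, j) = 1\<^sub>m n $$ (i, j)" using ij by simp
    qed (auto simp: H_def)
    moreover have "transpose_mat H = H"
      by (rule eq_matI) (auto simp: H_def)
    moreover have "col H 0 = v"
    proof (rule eq_vecI)
      fix i assume i: "i < dim_vec v"
      have "c * w 0 = -1" using False by (simp add: c_def w_def field_simps)
      then have "c * w i * w 0 = - w i" by (metis mult.assoc mult.commute mult_minus1)
      then show "col H 0 $ i = v $ i"
        using i v n by (auto simp: H_def w_def)
    qed (use H v in auto)
    ultimately show ?thesis using H by blast
  qed
qed

text \<open>Deflation by induction on the size. Conjugation by a reflection \<open>H\<close> whose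
  first column is a unit eigenvector leaves a block diagonal matrix with \<open>e\<close> in the
  corner and a smaller symmetric block \<open>B2\<close>. As \<open>H * H = 1\<close>, the same
  conjugation leads back to \<open>B\<close>.\<close>

theorem spectral_symmetric:
  fixes B :: "real mat"
  assumes "B \<in> carrier_mat n n" "transpose_mat B = B"
  shows "\<exists>P f. P \<in> carrier_mat n n \<and> transpose_mat P * P = 1\<^sub>m n \<and>
    B = P * mat_diag n f * transpose_mat P"
  using assms
proof (induction n arbitrary: B)
  case 0
  then show ?case by (intro exI[of _ "1\<^sub>m 0"] exI[of _ "\<lambda>_. 0"]) auto
next
  case (Suc n)
  let ?N = "Suc n"
  note B = Suc.prems(1)
  obtain v e where v: "v \<in> carrier_vec ?N" "v \<bullet> v = 1" "B *\<^sub>v v = e \<cdot>\<^sub>v v"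
    using symmetric_unit_eigenvector[OF Suc.prems] by auto
  obtain H where H: "H \<in> carrier_mat ?N ?N" "transpose_mat H = H" "H * H = 1\<^sub>m ?N" "col H 0 = v"
    using householder[OF v(1,2)] by auto
  define B' where "B' = H * B * H"
  have B': "B' \<in> carrier_mat ?N ?N" using B H by (simp add: B'_def)
  have "transpose_mat B' = transpose_mat H * (transpose_mat B * transpose_mat H)"
    unfolding B'_def using B H(1)
    by (subst transpose_mult[of _ ?N ?N _ ?N], simp, simp)
      (subst transpose_mult[of _ ?N ?N _ ?N], auto)
  also have "\<dots> = B'" unfolding B'_def H(2) Suc.prems(2) using B H(1) by simp
  finally have symB': "transpose_mat B' = B'" .
  have "col B' 0 = H *\<^sub>v (B *\<^sub>v col H 0)"
    unfolding B'_def using B H(1)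
    by (simp add: col_mult2[of _ ?N ?N _ ?N] mult_carrier_mat[of _ ?N ?N] del: col_mult)
  also have "\<dots> = e \<cdot>\<^sub>v (H *\<^sub>v col H 0)"
    unfolding H(4) v(3) using mult_mat_vec[OF H(1) v(1)] by simp
  also have "H *\<^sub>v col H 0 = col (H * H) 0"
    using H(1) by (simp add: col_mult2[of _ ?N ?N _ ?N] del: col_mult)
  also have "\<dots> = unit_vec ?N 0" unfolding H(3) by simp
  finally have colB': "col B' 0 = e \<cdot>\<^sub>v unit_vec ?N 0" .
  have B'0: "B' $$ (i, 0) = (if i = 0 then e else 0)" if "i < ?N" for i
    using arg_cong[OF colB', of "\<lambda>u. u $ i"] that B' by auto
  have symij: "B' $$ (i, j) = B' $$ (j, i)" if "i < ?N" "j < ?N" for i j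
    using that B' symB' by (metis carrier_matD index_transpose_mat(1))
  define B2 where "B2 = mat n n (\<lambda>(i, j). B' $$ (Suc i, Suc j))"
  have "transpose_mat B2 = B2"
    by (rule eq_matI) (auto simp: B2_def symij)
  then obtain P2 f2 where P2: "P2 \<in> carrier_mat n n" "transpose_mat P2 * P2 = 1\<^sub>m n"
    "B2 = P2 * mat_diag n f2 * transpose_mat P2"
    using Suc.IH[of B2] by (auto simp: B2_def)
  define P1 where "P1 = four_block_mat (1\<^sub>m 1) (0\<^sub>m 1 n) (0\<^sub>m n 1) P2"
  define f where "f i = (if i = 0 then e else f2 (i - 1))" for i
  have P1: "P1 \<in> carrier_mat ?N ?N"
    unfolding P1_def using four_block_carrier_mat[of "1\<^sub>m 1" 1 1 P2 n n] P2(1) by simp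
  have tP1: "transpose_mat P1 = four_block_mat (1\<^sub>m 1) (0\<^sub>m 1 n) (0\<^sub>m n 1) (transpose_mat P2)"
    unfolding P1_def using P2(1) by (subst transpose_four_block_mat[of _ 1 1 _ n _ n]) auto
  have one: "four_block_mat (1\<^sub>m 1) (0\<^sub>m 1 n) (0\<^sub>m n 1) (1\<^sub>m n) = (1\<^sub>m ?N :: real mat)"
    by (rule eq_matI) (auto split: if_splits)
  have blk: "four_block_mat A1 (0\<^sub>m 1 n) (0\<^sub>m n 1) D1 * four_block_mat A2 (0\<^sub>m 1 n) (0\<^sub>m n 1) D2 =
      four_block_mat (A1 * A2) (0\<^sub>m 1 n) (0\<^sub>m n 1) (D1 * D2)"
    if "A1 \<in> carrier_mat 1 1" "A2 \<in> carrier_mat 1 1" "D1 \<in> carrier_mat n n" "D2 \<in> carrier_mat n n"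
    for A1 A2 D1 D2 :: "real mat"
    using that by (subst mult_four_block_mat[of _ 1 1 _ n _ n _ _ 1 _ n]) auto
  have P1_orth: "transpose_mat P1 * P1 = 1\<^sub>m ?N"
    unfolding tP1 unfolding P1_def using P2 one by (subst blk) auto
  have D: "mat_diag ?N f = four_block_mat (mat 1 1 (\<lambda>_. e)) (0\<^sub>m 1 n) (0\<^sub>m n 1) (mat_diag n f2)"
    by (rule eq_matI) (auto simp: mat_diag_def f_def split: if_splits)
  have "P1 * mat_diag ?N f * transpose_mat P1 =
      four_block_mat (mat 1 1 (\<lambda>_. e)) (0\<^sub>m 1 n) (0\<^sub>m n 1) B2"
    unfolding D tP1 unfolding P1_def
    using P2(1) by (simp add: blk P2(3) del: One_nat_def)
  also have "\<dots> = B'"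
  proof (rule eq_matI)
    fix i j assume "i < dim_row B'" "j < dim_col B'"
    then have ij: "i < ?N" "j < ?N" using B' by auto
    then show "four_block_mat (mat 1 1 (\<lambda>_. e)) (0\<^sub>m 1 n) (0\<^sub>m n 1) B2 $$ (i, j) = B' $$ (i, j)"
      using B'0[of i] B'0[of j] symij[of i j] by (auto simp: B2_def)
  qed (use B' in \<open>auto simp: B2_def\<close>)
  finally have B'_eq: "B' = P1 * mat_diag ?N f * transpose_mat P1" by simp
  define P where "P = H * P1"
  have P: "P \<in> carrier_mat ?N ?N" using H(1) P1 by (simp add: P_def)
  have tP: "transpose_mat P = transpose_mat P1 * H"
    unfolding P_def using transpose_mult[OF H(1) P1] H(2) by simp
  have "transpose_mat P * P = transpose_mat P1 * (H * H) * P1"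
    unfolding tP unfolding P_def using H(1) P1 by (simp add: assoc_mult_mat[of _ ?N ?N _ ?N _ ?N])
  also have "\<dots> = 1\<^sub>m ?N" unfolding H(3) using P1 P1_orth by simp
  finally have P_orth: "transpose_mat P * P = 1\<^sub>m ?N" .
  have "P * mat_diag ?N f * transpose_mat P = H * B' * H"
    unfolding tP B'_eq unfolding P_def using H(1) P1
    by (simp add: assoc_mult_mat[of _ ?N ?N _ ?N _ ?N] mult_carrier_mat[of _ ?N ?N])
  also have "\<dots> = (H * H) * B * (H * H)"
    unfolding B'_def using H(1) B
    by (simp add: assoc_mult_mat[of _ ?N ?N _ ?N _ ?N] mult_carrier_mat[of _ ?N ?N])
  also have "\<dots> = B" unfolding H(3) using B by simp
  finally show ?case using P P_orth by metis
qed

section \<open>Orthogonally diagonalised matrices and square roots\<close>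

lemma orthogonal_mat_commute:
  fixes P :: "real mat"
  assumes "P \<in> carrier_mat n n" "transpose_mat P * P = 1\<^sub>m n"
  shows "P * transpose_mat P = 1\<^sub>m n"
  using mat_mult_left_right_inverse[OF _ assms(1,2)] assms(1) by simp

lemma orthogonal_diag_mult:
  fixes P :: "real mat"
  assumes P: "P \<in> carrier_mat n n" "transpose_mat P * P = 1\<^sub>m n"
  shows "(P * mat_diag n f * transpose_mat P) * (P * mat_diag n g * transpose_mat P) =
    P * mat_diag n (\<lambda>i. f i * g i) * transpose_mat P"
proof -
  note assoc = assoc_mult_mat[of _ n n _ n _ n] mult_carrier_mat[of _ n n]
  have "(P * mat_diag n f * transpose_mat P) * (P * mat_diag n g * transpose_mat P) =
      P * (mat_diag n f * ((transpose_mat P * P) * (mat_diag n g * transpose_mat P)))"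
    using P(1) by (simp add: assoc)
  also have "\<dots> = P * ((mat_diag n f * mat_diag n g) * transpose_mat P)"
    unfolding P(2) using P(1) by (simp add: assoc left_mult_one_mat[of _ n n] del: mat_diag_diag)
  also have "\<dots> = P * mat_diag n (\<lambda>i. f i * g i) * transpose_mat P"
    using P(1) by (simp add: assoc)
  finally show ?thesis .
qed

lemma orthogonal_diag_index:
  fixes P :: "real mat"
  assumes P: "P \<in> carrier_mat n n" and "i < n" "j < n"
  shows "(P * mat_diag n f * transpose_mat P) $$ (i, j) = (\<Sum>l<n. P $$ (i, l) * f l * P $$ (j, l))"
  unfolding mat_diag_mult_right[OF P]
  using assms by (simp add: scalar_prod_def lessThan_atLeast0)

lemma orthogonal_diag_sym:
  fixes P :: "real mat"
  assumes P: "P \<in> carrier_mat n n"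
  shows "transpose_mat (P * mat_diag n f * transpose_mat P) = P * mat_diag n f * transpose_mat P"
proof (rule eq_matI)
  fix i j
  assume "i < dim_row (P * mat_diag n f * transpose_mat P)"
    "j < dim_col (P * mat_diag n f * transpose_mat P)"
  then have ij: "i < n" "j < n" using P by auto
  then have "transpose_mat (P * mat_diag n f * transpose_mat P) $$ (i, j) =
      (P * mat_diag n f * transpose_mat P) $$ (j, i)"
    using P by simp
  then show "transpose_mat (P * mat_diag n f * transpose_mat P) $$ (i, j) =
      (P * mat_diag n f * transpose_mat P) $$ (i, j)"
    unfolding orthogonal_diag_index[OF P ij] orthogonal_diag_index[OF P ij(2,1)]
    by (simp add: mult_ac)
qed (use P in auto)

lemma orthogonal_diag_eigenvector:
  fixes P :: "real mat"
  assumes P: "P \<in> carrier_mat n n" "transpose_mat P * P = 1\<^sub>m n" and i: "i < n"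
  shows "(P * mat_diag n f * transpose_mat P) *\<^sub>v col P i = f i \<cdot>\<^sub>v col P i"
proof -
  note assoc = assoc_mult_mat[of _ n n _ n _ n] mult_carrier_mat[of _ n n]
  have "col P i \<in> carrier_vec n" using P(1) by (intro carrier_vecI) auto
  then have "(P * mat_diag n f * transpose_mat P) *\<^sub>v col P i =
      col (P * mat_diag n f * transpose_mat P * P) i"
    using P(1) i
    by (simp add: col_mult2[of _ n n _ n] assoc assoc_mult_mat_vec[of _ n n _ n]
        mult_mat_vec_carrier[of _ n n] del: col_mult)
  also have "P * mat_diag n f * transpose_mat P * P = P * mat_diag n f * (transpose_mat P * P)"
    using P(1) by (simp add: assoc)
  also have "\<dots> = mat n n (\<lambda>(i, j). P $$ (i, j) * f j)"
    unfolding P(2) mat_diag_mult_right[OF P(1)] by simp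
  also have "col \<dots> i = f i \<cdot>\<^sub>v col P i"
    using P(1) i by (intro eq_vecI) auto
  finally show ?thesis .
qed

lemma orthogonal_col_norm:
  fixes P :: "real mat"
  assumes P: "P \<in> carrier_mat n n" "transpose_mat P * P = 1\<^sub>m n" and i: "i < n"
  shows "col P i \<bullet> col P i = 1"
  using arg_cong[OF P(2), of "\<lambda>M. M $$ (i, i)"] P(1) i by simp

lemma psd_orthogonal_diag:
  fixes P :: "real mat"
  assumes P: "P \<in> carrier_mat n n" and f: "\<And>i. i < n \<Longrightarrow> 0 \<le> f i"
  shows "psd_mat (P * mat_diag n f * transpose_mat P)"
  unfolding psd_mat_def
proof (intro conjI ballI)
  fix x :: "real vec" assume "x \<in> carrier_vec (dim_row (P * mat_diag n f * transpose_mat P))"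
  then have x: "x \<in> carrier_vec n" using P by simp
  define z where "z = transpose_mat P *\<^sub>v x"
  have z: "z \<in> carrier_vec n" unfolding z_def using P by (intro carrier_vecI) auto
  have "(P * mat_diag n f * transpose_mat P) *\<^sub>v x = P *\<^sub>v (mat_diag n f *\<^sub>v z)"
    using P x by (simp add: z_def assoc_mult_mat_vec[of _ n n _ n] mult_carrier_mat[of _ n n])
  then have "x \<bullet> ((P * mat_diag n f * transpose_mat P) *\<^sub>v x) = z \<bullet> (mat_diag n f *\<^sub>v z)"
    unfolding z_def using P x
    by (simp add: transpose_vec_mult_scalar[of P n n] mult_mat_vec_carrier[of _ n n])
  also have "\<dots> = (\<Sum>i<n. z $ i * (f i * z $ i))"
    using z by (auto simp: scalar_prod_def mat_diag_def lessThan_atLeast0 if_distrib[of "\<lambda>a. a * _"]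
      intro!: sum.cong cong: if_cong)
  also have "\<dots> \<ge> 0"
    by (intro sum_nonneg) (use f in \<open>simp add: mult.left_commute[of _ "f _"]\<close>)
  finally show "0 \<le> x \<bullet> ((P * mat_diag n f * transpose_mat P) *\<^sub>v x)" .
qed (use P orthogonal_diag_sym[OF P] in auto)

lemma psd_spectral:
  assumes B: "psd_mat B" "B \<in> carrier_mat n n"
  shows "\<exists>P f. P \<in> carrier_mat n n \<and> transpose_mat P * P = 1\<^sub>m n \<and> (\<forall>i<n. 0 \<le> f i) \<and>
    B = P * mat_diag n f * transpose_mat P"
proof -
  obtain P f where P: "P \<in> carrier_mat n n" "transpose_mat P * P = 1\<^sub>m n"
    and Beq: "B = P * mat_diag n f * transpose_mat P"
    using spectral_symmetric[OF B(2)] B(1) by (auto simp: psd_mat_def)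
  have "0 \<le> f i" if i: "i < n" for i
  proof -
    have "0 \<le> col P i \<bullet> (B *\<^sub>v col P i)"
      using B P(1) by (auto simp: psd_mat_def)
    also have "\<dots> = f i * (col P i \<bullet> col P i)"
      unfolding Beq orthogonal_diag_eigenvector[OF P i] using P(1) by simp
    finally show ?thesis unfolding orthogonal_col_norm[OF P i] by simp
  qed
  then show ?thesis using P Beq by blast
qed

text \<open>Let \<open>p\<close> be an eigenvector of \<open>B\<close> with eigenvalue
  \<open>f\<close>, and \<open>z = S p - f p\<close>. From \<open>S S p = f f p\<close> follows
  \<open>S z = - f z\<close>. If \<open>f > 0\<close>, positivity of \<open>S\<close> forces
  \<open>z = 0\<close>; if \<open>f = 0\<close>, then \<open>z = S p\<close> and its squared norm is
  \<open>p \<bullet> S z = 0\<close>. So \<open>S\<close> and \<open>B\<close> agree on an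
  orthonormal basis.\<close>

lemma psd_sqrt_unique:
  assumes B: "psd_mat B" "B \<in> carrier_mat n n" and S: "psd_mat S" "S \<in> carrier_mat n n"
    and eq: "B * B = S * S"
  shows "B = S"
proof -
  obtain P f where P: "P \<in> carrier_mat n n" "transpose_mat P * P = 1\<^sub>m n"
    and f: "\<forall>i<n. 0 \<le> f i" and Beq: "B = P * mat_diag n f * transpose_mat P"
    using psd_spectral[OF B] by blast
  have col_eq: "S *\<^sub>v col P i = B *\<^sub>v col P i" if i: "i < n" for i
  proof -
    define p where "p = col P i"
    define z where "z = S *\<^sub>v p - f i \<cdot>\<^sub>v p"
    have p: "p \<in> carrier_vec n" unfolding p_def using P(1) by (intro carrier_vecI) auto
    have Sp: "S *\<^sub>v p \<in> carrier_vec n" using S(2) p by simp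
    have z: "z \<in> carrier_vec n" using Sp p by (simp add: z_def)
    have Bp: "B *\<^sub>v p = f i \<cdot>\<^sub>v p"
      unfolding p_def Beq by (rule orthogonal_diag_eigenvector[OF P i])
    have SSp: "S *\<^sub>v (S *\<^sub>v p) = f i \<cdot>\<^sub>v (f i \<cdot>\<^sub>v p)"
    proof -
      have "S *\<^sub>v (S *\<^sub>v p) = B *\<^sub>v (B *\<^sub>v p)"
        using eq S(2) B(2) p by (metis assoc_mult_mat_vec)
      then show ?thesis unfolding Bp mult_mat_vec[OF B(2) p] .
    qed
    have Sz: "S *\<^sub>v z = - f i \<cdot>\<^sub>v z"
    proof -
      have "S *\<^sub>v z = S *\<^sub>v (S *\<^sub>v p) - f i \<cdot>\<^sub>v (S *\<^sub>v p)"
        unfolding z_def using S(2) p Sp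
        by (simp add: mult_minus_distrib_mat_vec[of _ n n] mult_mat_vec[of _ n n])
      also have "\<dots> = - f i \<cdot>\<^sub>v z"
      proof -
        have "f i \<cdot>\<^sub>v (f i \<cdot>\<^sub>v p) - f i \<cdot>\<^sub>v q = - f i \<cdot>\<^sub>v (q - f i \<cdot>\<^sub>v p)"
          if "q \<in> carrier_vec n" for q
          using that p by (intro eq_vecI) (auto simp: right_diff_distrib)
        then show ?thesis unfolding SSp z_def using Sp by blast
      qed
      finally show ?thesis .
    qed
    have "z \<bullet> z = 0"
    proof (cases "f i = 0")
      case True
      have zS: "z = S *\<^sub>v p" unfolding z_def True using S(2) p by (intro eq_vecI) auto
      have "z \<bullet> z = (transpose_mat S *\<^sub>v p) \<bullet> (S *\<^sub>v p)"
        unfolding zS using S(1) by (simp add: psd_mat_def)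
      also have "\<dots> = p \<bullet> (S *\<^sub>v z)"
        unfolding zS by (rule transpose_vec_mult_scalar[OF S(2) Sp p])
      also have "\<dots> = 0" unfolding Sz True using z p by simp
      finally show ?thesis .
    next
      case False
      then have "0 < f i" using f i by (simp add: less_le)
      have "0 \<le> z \<bullet> (S *\<^sub>v z)" using S z by (auto simp: psd_mat_def)
      also have "\<dots> = - f i * (z \<bullet> z)" unfolding Sz using z by simp
      finally have "z \<bullet> z \<le> 0" using \<open>0 < f i\<close> by (simp add: mult_le_0_iff)
      then show ?thesis using scalar_prod_self_nonneg[of z] by simp
    qed
    then have z0: "z = 0\<^sub>v n" using scalar_prod_eq_0_real[of z] z by simp
    have "S *\<^sub>v p = f i \<cdot>\<^sub>v p"
    proof (rule eq_vecI)
      fix j assume "j < dim_vec (f i \<cdot>\<^sub>v p)"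
      then show "(S *\<^sub>v p) $ j = (f i \<cdot>\<^sub>v p) $ j"
        using arg_cong[OF z0, of "\<lambda>u. u $ j"] p Sp by (simp add: z_def)
    qed (use p S(2) in auto)
    then show ?thesis using Bp by (simp add: p_def)
  qed
  have "S * P = B * P"
  proof (rule mat_col_eqI)
    fix i assume "i < dim_col (B * P)"
    then have "i < n" using P(1) by simp
    then show "col (S * P) i = col (B * P) i"
      using col_eq[of i] col_mult2[OF S(2) P(1)] col_mult2[OF B(2) P(1)] by (simp del: col_mult)
  qed (use S B P in auto)
  then have "S * (P * transpose_mat P) = B * (P * transpose_mat P)"
    using assoc_mult_mat[OF S(2) P(1), of "transpose_mat P" n]
      assoc_mult_mat[OF B(2) P(1), of "transpose_mat P" n] P(1) by (metis transpose_carrier_mat)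
  then show ?thesis
    unfolding orthogonal_mat_commute[OF P] using S(2) B(2) by simp
qed

text \<open>\<open>mat_sqrt\<close> is a definite description, so both existence and uniqueness are
  required before anything is known about it.\<close>

lemma mat_sqrt:
  assumes G: "psd_mat G" "G \<in> carrier_mat n n"
  shows "mat_sqrt G \<in> carrier_mat n n \<and> psd_mat (mat_sqrt G) \<and> mat_sqrt G * mat_sqrt G = G"
proof -
  obtain P f where P: "P \<in> carrier_mat n n" "transpose_mat P * P = 1\<^sub>m n"
    and f: "\<forall>i<n. 0 \<le> f i" and Geq: "G = P * mat_diag n f * transpose_mat P"
    using psd_spectral[OF G] by blast
  define S where "S = P * mat_diag n (\<lambda>i. sqrt (f i)) * transpose_mat P"
  have S: "S \<in> carrier_mat n n" "psd_mat S"
    using P(1) f psd_orthogonal_diag[OF P(1), of "\<lambda>i. sqrt (f i)"] by (auto simp: S_def)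
  have "mat_diag n (\<lambda>i. sqrt (f i) * sqrt (f i)) = mat_diag n f"
    by (rule eq_matI) (use f in \<open>auto simp: mat_diag_def\<close>)
  then have SS: "S * S = G"
    unfolding S_def orthogonal_diag_mult[OF P] Geq by simp
  have "\<exists>!B. B \<in> carrier_mat (dim_row G) (dim_row G) \<and> psd_mat B \<and> B * B = G"
  proof (rule ex1I[of _ S])
    fix B assume B: "B \<in> carrier_mat (dim_row G) (dim_row G) \<and> psd_mat B \<and> B * B = G"
    then show "B = S"
      using psd_sqrt_unique[of B n S] S SS G(2) by auto
  qed (use S SS G(2) in auto)
  from theI'[OF this] show ?thesis unfolding mat_sqrt_def using G(2) by simp
qed

text \<open>Similar matrices share their characteristic polynomial, and that of a diagonal matrix is
  a product of linear factors.\<close>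

lemma mset_proots_orthogonal_diag:
  fixes P :: "real mat"
  assumes P: "P \<in> carrier_mat n n" "transpose_mat P * P = 1\<^sub>m n"
  shows "proots (char_poly (P * mat_diag n f * transpose_mat P)) = mset (map f [0..<n])"
proof -
  let ?B = "P * mat_diag n f * transpose_mat P"
  have "similar_mat ?B (mat_diag n f)"
    by (rule similar_matI[of _ _ P "transpose_mat P" n])
      (use P orthogonal_mat_commute[OF P] in auto)
  then have "char_poly ?B = char_poly (mat_diag n f)" by (rule char_poly_similar)
  also have "\<dots> = (\<Prod>a\<leftarrow>diag_mat (mat_diag n f). [:- a, 1:])"
    by (rule char_poly_upper_triangular[of _ n])
      (auto simp: mat_diag_def upper_triangular_def)
  also have "diag_mat (mat_diag n f) = map f [0..<n]"
    by (auto simp: diag_mat_def mat_diag_def intro: nth_equalityI)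
  finally have *: "char_poly ?B = (\<Prod>a\<leftarrow>map f [0..<n]. [:- a, 1:])" .
  have "proots (\<Prod>a\<leftarrow>as. [:- a, 1:]) = mset as" for as :: "real list"
  proof (induction as)
    case (Cons a as)
    have "(\<Prod>a\<leftarrow>as. [:- a, 1:]) \<noteq> 0" by (auto simp: prod_list_zero_iff)
    then show ?case
      using Cons.IH proots_mult[of "[:- a, 1:]"] by (simp del: mult_pCons_left)
  qed simp
  then show ?thesis unfolding * .
qed

section \<open>Singular values and rank\<close>

text \<open>\<open>f\<close> lists the eigenvalues of the square root in the order of the columns of
  \<open>P\<close>, which need not be decreasing; therefore only multisets are compared.\<close>

theorem gram_spectral_singular_values:
  assumes A: "A \<in> carrier_mat n m"
  obtains P f where "P \<in> carrier_mat m m" "transpose_mat P * P = 1\<^sub>m m" "\<And>i. i < m \<Longrightarrow> 0 \<le> f i"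
    "transpose_mat A * A = P * mat_diag m (\<lambda>i. (f i)\<^sup>2) * transpose_mat P"
    "mset (singular_values A) = mset (map f [0..<m])"
proof -
  let ?G = "transpose_mat A * A"
  have G: "?G \<in> carrier_mat m m" using A by simp
  have "psd_mat ?G"
    unfolding psd_mat_def
  proof (intro conjI ballI)
    show "transpose_mat ?G = ?G" using A by (simp add: transpose_mult[of _ m n _ m])
    fix x :: "real vec" assume "x \<in> carrier_vec (dim_row ?G)"
    then have x: "x \<in> carrier_vec m" using A by simp
    have "x \<bullet> (?G *\<^sub>v x) = (?G *\<^sub>v x) \<bullet> x"
      by (rule comm_scalar_prod[of _ m]) (use x G in auto)
    also have "\<dots> = (A *\<^sub>v x) \<bullet> (A *\<^sub>v x)"
      using transpose_vec_mult_scalar[OF A x, of "A *\<^sub>v x"] A x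
      by (simp add: assoc_mult_mat_vec[of _ m n _ m])
    finally show "0 \<le> x \<bullet> (?G *\<^sub>v x)" using scalar_prod_self_nonneg by simp
  qed (use A in auto)
  note S = mat_sqrt[OF this G]
  then obtain P f where P: "P \<in> carrier_mat m m" "transpose_mat P * P = 1\<^sub>m m"
    and f: "\<forall>i<m. 0 \<le> f i" and Seq: "mat_sqrt ?G = P * mat_diag m f * transpose_mat P"
    using psd_spectral by blast
  have "?G = P * mat_diag m (\<lambda>i. (f i)\<^sup>2) * transpose_mat P"
    using S unfolding Seq orthogonal_diag_mult[OF P] by (simp add: power2_eq_square)
  moreover have "mset (singular_values A) = mset (map f [0..<m])"
    unfolding singular_values_def Seq mset_rev mset_sorted_list_of_multiset
    by (rule mset_proots_orthogonal_diag[OF P])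
  ultimately show thesis using that P f by blast
qed

text \<open>The columns of \<open>A * P\<close> generate the column space of \<open>A\<close>, and
  column \<open>i\<close> has squared norm \<open>(f i)\<^sup>2\<close>, so it vanishes when
  \<open>f i = 0\<close>. This later makes the \<open>r\<close>-th singular value positive for
  \<open>r\<close> up to the rank.\<close>

lemma rank_le_nonzero_singular:
  fixes A P :: "real mat"
  assumes A: "A \<in> carrier_mat n m" and P: "P \<in> carrier_mat m m" "transpose_mat P * P = 1\<^sub>m m"
    and G: "transpose_mat A * A = P * mat_diag m (\<lambda>i. (f i)\<^sup>2) * transpose_mat P"
  shows "vec_space.rank n A \<le> card {i. i < m \<and> f i \<noteq> 0}"
proof -
  interpret vec_space "TYPE(real)" n .
  define w where "w i = A *\<^sub>v col P i" for i
  have w: "w i \<in> carrier_vec n" for i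
    unfolding w_def using A by (intro carrier_vecI) auto
  have w0: "w i = 0\<^sub>v n" if i: "i < m" "f i = 0" for i
  proof -
    have p: "col P i \<in> carrier_vec m" using P(1) by (intro carrier_vecI) auto
    have "w i \<bullet> w i = (transpose_mat A *\<^sub>v w i) \<bullet> col P i"
      using transpose_vec_mult_scalar[OF A p w[of i]] by (simp add: w_def)
    also have "transpose_mat A *\<^sub>v w i = (transpose_mat A * A) *\<^sub>v col P i"
      unfolding w_def using A p by (simp add: assoc_mult_mat_vec[of _ m n _ m])
    also have "\<dots> = 0 \<cdot>\<^sub>v col P i"
      unfolding G orthogonal_diag_eigenvector[OF P i(1)] i(2) by simp
    also have "(0 \<cdot>\<^sub>v col P i) \<bullet> col P i = 0" using p by simp
    finally show ?thesis using scalar_prod_eq_0_real[of "w i"] w[of i] by simp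
  qed
  define T where "T = w ` {i. i < m \<and> f i \<noteq> 0}"
  have T: "T \<subseteq> carrier_vec n" "finite T" using w by (auto simp: T_def)
  define ws where "ws = map w [0..<m]"
  have ws: "set ws \<subseteq> carrier_vec n" using w by (auto simp: ws_def)
  have "set ws \<subseteq> span T"
  proof
    fix x assume "x \<in> set ws"
    then obtain i where i: "i < m" "x = w i" by (auto simp: ws_def)
    show "x \<in> span T"
    proof (cases "f i = 0")
      case True
      then have "x = lincomb (\<lambda>_. 0) {}" using w0[OF i(1)] i(2) by (simp add: lincomb_def)
      then show ?thesis by (rule in_spanI) auto
    next
      case False
      then show ?thesis using i in_own_span[OF T(1)] by (auto simp: T_def)
    qed
  qed
  then have span_ws: "span (set ws) \<subseteq> span T"
    by (rule span_subsetI[OF T(1)])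
  have AP: "A * P = mat_of_cols n ws"
  proof (rule mat_col_eqI)
    fix i assume "i < dim_col (mat_of_cols n ws)"
    then have i: "i < m" by (simp add: ws_def)
    have "col (mat_of_cols n ws) i = ws ! i"
      by (rule col_mat_of_cols) (use i w in \<open>auto simp: ws_def\<close>)
    then show "col (A * P) i = col (mat_of_cols n ws) i"
      using i A P(1) by (simp add: ws_def w_def col_mult2[of _ n m _ m] del: col_mult)
  qed (use A P(1) in \<open>auto simp: ws_def\<close>)
  have "set (cols A) \<subseteq> span T"
  proof
    fix x assume "x \<in> set (cols A)"
    then obtain j where j: "j < m" "x = col A j" using A by (auto simp: cols_def)
    define z where "z = col (transpose_mat P) j"
    have z: "z \<in> carrier_vec m" unfolding z_def using P(1) by (intro carrier_vecI) auto
    have "A = A * P * transpose_mat P"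
      using orthogonal_mat_commute[OF P] A P(1) by (simp add: assoc_mult_mat[of _ n m _ m _ m])
    then have "x = col (A * P * transpose_mat P) j" using j by simp
    also have "\<dots> = mat_of_cols n ws *\<^sub>v z"
      unfolding z_def AP[symmetric] using A P(1) j
      by (simp add: col_mult2[of _ n m _ m] mult_carrier_mat[of _ n m] del: col_mult)
    also have "z = vec (length ws) (\<lambda>i. z $ i)" using z by (auto simp: ws_def)
    also have "mat_of_cols n ws *\<^sub>v \<dots> = lincomb_list (\<lambda>i. z $ i) ws"
      by (rule lincomb_list_as_mat_mult[symmetric]) (use ws in auto)
    also have "\<dots> \<in> span (set ws)"
      unfolding span_list_as_span[OF ws, symmetric] by (rule in_span_listI[OF _ refl]) simp
    finally show "x \<in> span T" using span_ws by blast
  qed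
  \<comment> \<open>The rank is the size of a maximal independent set \<open>U\<close> of columns;
    the exchange lemma compares \<open>U\<close> with the generating set \<open>T\<close>.\<close>
  moreover have "\<exists>U. finite U \<and> maximal U (\<lambda>T. T \<subseteq> set (cols A) \<and> lin_indpt T) \<and> {} \<subseteq> U"
    by (rule maximal_exists_superset[of "set (cols A)"]) (simp_all add: lin_dep_def)
  then obtain U where U: "maximal U (\<lambda>T. T \<subseteq> set (cols A) \<and> lin_indpt T)" "finite U"
    by blast
  moreover from U(1) have U': "U \<subseteq> set (cols A)" "lin_indpt U" by (simp_all add: maximal_def)
  ultimately have "U \<subseteq> span T" by blast
  moreover have "U \<subseteq> carrier_vec n" using U'(1) cols_dim[of A] A by auto
  ultimately obtain C :: "real vec set" where "int (card C) \<le> int (card T) - int (card U)"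
    using replacement[of U T] U(2) U'(2) T by auto
  then have "card U \<le> card T" by linarith
  also have "\<dots> \<le> card {i. i < m \<and> f i \<noteq> 0}" unfolding T_def by (rule card_image_le) simp
  finally show ?thesis unfolding rank_card_indpt[OF A U(1)] .
qed

section \<open>Restricted invertibility\<close>

lemma vnorm_nonneg: "0 \<le> vnorm x"
  by (simp add: vnorm_def scalar_prod_self_nonneg)

lemma vnorm_eq_0: "x \<in> carrier_vec n \<Longrightarrow> vnorm x = 0 \<Longrightarrow> x = 0\<^sub>v n"
  using scalar_prod_eq_0_real[of x] by (simp add: vnorm_def)

text \<open>The lower bound gives injectivity, which excludes the infinite value, and it bounds the
  preimage of every vector of norm at most 1.\<close>

lemma inverse_op_norm_le:
  assumes B: "B \<in> carrier_mat n k" and c: "0 < c"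
    and lower: "\<And>x. x \<in> carrier_vec k \<Longrightarrow> c * vnorm x \<le> vnorm (B *\<^sub>v x)"
  shows "inverse_op_norm B \<le> ereal (1 / c)"
proof -
  have inj: "inj_on (\<lambda>x. B *\<^sub>v x) (carrier_vec k)"
  proof (rule inj_onI)
    fix x y assume xy: "x \<in> carrier_vec k" "y \<in> carrier_vec k" "B *\<^sub>v x = B *\<^sub>v y"
    have "B *\<^sub>v (x - y) = B *\<^sub>v y - B *\<^sub>v y"
      using mult_minus_distrib_mat_vec[OF B xy(1,2)] xy(3) by simp
    also have "\<dots> = 0\<^sub>v n" using mult_mat_vec_carrier[OF B xy(2)] by simp
    finally have "vnorm (B *\<^sub>v (x - y)) = 0" by (simp add: vnorm_def)
    then have "vnorm (x - y) = 0"
      using lower[of "x - y"] vnorm_nonneg[of "x - y"] c xy(1,2) by (simp add: mult_le_0_iff)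
    then have z: "x - y = 0\<^sub>v k" using vnorm_eq_0[of "x - y" k] xy(1,2) by simp
    show "x = y"
    proof (rule eq_vecI)
      fix i assume "i < dim_vec y"
      then show "x $ i = y $ i" using arg_cong[OF z, of "\<lambda>u. u $ i"] xy(1,2) by simp
    qed (use xy in simp)
  qed
  have "op_norm_on ((\<lambda>x. B *\<^sub>v x) ` carrier_vec k) (inv_into (carrier_vec k) (\<lambda>x. B *\<^sub>v x)) \<le> ereal (1 / c)"
    unfolding op_norm_on_def
  proof (rule SUP_least)
    fix y assume "y \<in> {y \<in> (\<lambda>x. B *\<^sub>v x) ` carrier_vec k. vnorm y \<le> 1}"
    then obtain x where x: "x \<in> carrier_vec k" "y = B *\<^sub>v x" "vnorm y \<le> 1" by blast
    have "c * vnorm x \<le> 1" using lower[OF x(1)] x(2,3) by simp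
    then show "ereal (vnorm (inv_into (carrier_vec k) (\<lambda>x. B *\<^sub>v x) y)) \<le> ereal (1 / c)"
      unfolding x(2) inv_into_f_f[OF inj x(1)] using c by (simp add: field_simps)
  qed
  then show ?thesis
    unfolding inverse_op_norm_def Let_def using inj B by simp
qed

section \<open>Coordinate inclusions and the Gram form\<close>

lemma incl_mat_carrier: "finite \<sigma> \<Longrightarrow> incl_mat m \<sigma> \<in> carrier_mat m (card \<sigma>)"
  unfolding incl_mat_def by (intro carrier_matI) simp_all

lemma incl_mat_index:
  assumes "\<sigma> \<subseteq> {..<m}" "i < m" "j < card \<sigma>"
  shows "incl_mat m \<sigma> $$ (i, j) = (if i = sorted_list_of_set \<sigma> ! j then 1 else 0)"
proof -
  have fin: "finite \<sigma>" using assms(1) finite_subset by blast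
  then have "sorted_list_of_set \<sigma> ! j \<in> \<sigma>"
    using assms(3) by (metis length_sorted_list_of_set nth_mem set_sorted_list_of_set)
  then show ?thesis
    using assms fin by (auto simp: incl_mat_def mat_of_cols_index)
qed

text \<open>The inclusion is an isometry because its transpose maps \<open>u\<close> back to
  \<open>x\<close>; this uses that the increasing enumeration of \<open>\<sigma>\<close> has no
  repetitions.\<close>

lemma incl_mat_mult_vec:
  assumes \<sigma>: "\<sigma> \<subseteq> {..<m}" and x: "x \<in> carrier_vec (card \<sigma>)"
  defines "u \<equiv> incl_mat m \<sigma> *\<^sub>v x"
  shows "u \<in> carrier_vec m" "\<And>i. i < m \<Longrightarrow> i \<notin> \<sigma> \<Longrightarrow> u $ i = 0" "u \<bullet> u = x \<bullet> x"
proof -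
  let ?s = "sorted_list_of_set \<sigma>"
  have fin: "finite \<sigma>" using \<sigma> finite_subset by blast
  note I = incl_mat_carrier[OF fin, of m]
  have s: "?s ! j \<in> \<sigma>" if "j < card \<sigma>" for j
    using that fin by (metis length_sorted_list_of_set nth_mem set_sorted_list_of_set)
  have s_inj: "?s ! i = ?s ! j \<longleftrightarrow> i = j" if "i < card \<sigma>" "j < card \<sigma>" for i j
    using that by (simp add: nth_eq_iff_index_eq)
  have u_i: "u $ i = (\<Sum>j<card \<sigma>. (if i = ?s ! j then x $ j else 0))" if i: "i < m" for i
    unfolding u_def using I x i incl_mat_index[OF \<sigma> i]
    by (auto simp: scalar_prod_def lessThan_atLeast0 intro!: sum.cong)
  show "u \<in> carrier_vec m" unfolding u_def using I x by (rule mult_mat_vec_carrier)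
  show "u $ i = 0" if "i < m" "i \<notin> \<sigma>" for i
    unfolding u_i[OF that(1)] by (rule sum.neutral) (use s that(2) in auto)
  have u_s: "u $ (?s ! j) = x $ j" if j: "j < card \<sigma>" for j
  proof -
    have "?s ! j < m" using s[OF j] \<sigma> by auto
    then have "u $ (?s ! j) = (\<Sum>l<card \<sigma>. (if l = j then x $ l else 0))"
      unfolding u_i[OF \<open>?s ! j < m\<close>] using j s_inj by (intro sum.cong refl) auto
    then show ?thesis using j by simp
  qed
  have "u \<bullet> u = u \<bullet> (incl_mat m \<sigma> *\<^sub>v x)" by (simp add: u_def)
  also have "\<dots> = (transpose_mat (incl_mat m \<sigma>) *\<^sub>v u) \<bullet> x"
    by (rule transpose_vec_mult_scalar[OF I x \<open>u \<in> carrier_vec m\<close>, symmetric])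
  also have "transpose_mat (incl_mat m \<sigma>) *\<^sub>v u = x"
  proof (rule eq_vecI)
    fix j assume "j < dim_vec x"
    then have j: "j < card \<sigma>" using x by simp
    have "?s ! j < m" using s[OF j] \<sigma> by auto
    have "(transpose_mat (incl_mat m \<sigma>) *\<^sub>v u) $ j =
        (\<Sum>i<m. (if i = ?s ! j then 1 else 0) * u $ i)"
      using I j \<open>u \<in> carrier_vec m\<close> incl_mat_index[OF \<sigma> _ j]
      by (simp add: scalar_prod_def lessThan_atLeast0)
    also have "\<dots> = (\<Sum>i<m. if i = ?s ! j then u $ i else 0)"
      by (intro sum.cong refl) auto
    also have "\<dots> = x $ j" using \<open>?s ! j < m\<close> u_s[OF j] by simp
    finally show "(transpose_mat (incl_mat m \<sigma>) *\<^sub>v u) $ j = x $ j" .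
  qed (use I x in auto)
  finally show "u \<bullet> u = x \<bullet> x" .
qed

lemma mult_mat_vec_index:
  assumes "B \<in> carrier_mat n m" "u \<in> carrier_vec m" "i < n"
  shows "(B *\<^sub>v u) $ i = (\<Sum>j<m. B $$ (i, j) * u $ j)"
  using assms by (simp add: scalar_prod_def lessThan_atLeast0)

lemma mult_mat_index:
  assumes "B \<in> carrier_mat n m" "C \<in> carrier_mat m p" "i < n" "j < p"
  shows "(B * C) $$ (i, j) = (\<Sum>l<m. B $$ (i, l) * C $$ (l, j))"
  using assms by (simp add: scalar_prod_def lessThan_atLeast0)

lemma gram_quad:
  fixes A :: "real mat"
  assumes A: "A \<in> carrier_mat n m" and u: "u \<in> carrier_vec m"
    and \<sigma>: "\<sigma> \<subseteq> {..<m}" "\<And>i. i < m \<Longrightarrow> i \<notin> \<sigma> \<Longrightarrow> u $ i = 0"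
  shows "(\<Sum>i\<in>\<sigma>. \<Sum>j\<in>\<sigma>. u $ i * (transpose_mat A * A) $$ (i, j) * u $ j) = (A *\<^sub>v u) \<bullet> (A *\<^sub>v u)"
proof -
  let ?G = "transpose_mat A * A"
  have "(A *\<^sub>v u) \<bullet> (A *\<^sub>v u) = (?G *\<^sub>v u) \<bullet> u"
    using transpose_vec_mult_scalar[OF A u, of "A *\<^sub>v u"] A u
    by (simp add: assoc_mult_mat_vec[of _ m n _ m])
  also have "\<dots> = u \<bullet> (?G *\<^sub>v u)"
    by (rule comm_scalar_prod[of _ m]) (use u A in auto)
  also have "\<dots> = (\<Sum>i<m. u $ i * (?G *\<^sub>v u) $ i)"
    using A u by (simp add: scalar_prod_def lessThan_atLeast0)
  also have "\<dots> = (\<Sum>i<m. \<Sum>j<m. u $ i * ?G $$ (i, j) * u $ j)"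
  proof (intro sum.cong refl)
    fix i assume "i \<in> {..<m}"
    then have "(?G *\<^sub>v u) $ i = (\<Sum>j<m. ?G $$ (i, j) * u $ j)"
      using A u by (intro mult_mat_vec_index[of _ m]) auto
    then show "u $ i * (?G *\<^sub>v u) $ i = (\<Sum>j<m. u $ i * ?G $$ (i, j) * u $ j)"
      by (simp only: sum_distrib_left mult.assoc)
  qed
  also have "\<dots> = (\<Sum>i\<in>\<sigma>. \<Sum>j<m. u $ i * ?G $$ (i, j) * u $ j)"
    by (rule sum.mono_neutral_right) (use \<sigma> in auto)
  also have "\<dots> = (\<Sum>i\<in>\<sigma>. \<Sum>j\<in>\<sigma>. u $ i * ?G $$ (i, j) * u $ j)"
    by (rule sum.cong[OF refl], rule sum.mono_neutral_right) (use \<sigma> in auto)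
  finally show ?thesis by simp
qed

text \<open>For \<open>u\<close> supported in \<open>\<sigma>\<close> the Gram form at
  \<open>u\<close> is \<open>|A u|^2\<close>, so positivity of the shifted kernel yields
  \<open>|A u|^2 \<ge> b |u|^2\<close>, a lower bound for the restricted operator.\<close>

lemma inverse_op_norm_gram_le:
  fixes A :: "real mat"
  assumes A: "A \<in> carrier_mat n m" and \<sigma>: "\<sigma> \<subseteq> {..<m}" and b: "0 < b"
    and pd: "pos_def_on \<sigma> (shift (\<lambda>i j. (transpose_mat A * A) $$ (i, j)) b)"
  shows "inverse_op_norm (A * incl_mat m \<sigma>) \<le> ereal (1 / sqrt b)"
proof (rule inverse_op_norm_le)
  have fin: "finite \<sigma>" using \<sigma> finite_subset by blast
  note I = incl_mat_carrier[OF fin, of m]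
  show "A * incl_mat m \<sigma> \<in> carrier_mat n (card \<sigma>)" using A I by simp
  show "0 < sqrt b" using b by simp
  fix x :: "real vec" assume x: "x \<in> carrier_vec (card \<sigma>)"
  define u where "u = incl_mat m \<sigma> *\<^sub>v x"
  note u = incl_mat_mult_vec[OF \<sigma> x, folded u_def]
  have "0 \<le> (A *\<^sub>v u) \<bullet> (A *\<^sub>v u) - b * (\<Sum>i\<in>\<sigma>. (u $ i)\<^sup>2)"
    using pos_def_on_nonneg[OF pd, of "\<lambda>i. u $ i"] gram_quad[OF A u(1) \<sigma> u(2)]
    unfolding quad_shift[OF fin] by linarith
  also have "(\<Sum>i\<in>\<sigma>. (u $ i)\<^sup>2) = (\<Sum>i<m. (u $ i)\<^sup>2)"
    by (rule sum.mono_neutral_left) (use \<sigma> u(2) in auto)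
  also have "\<dots> = u \<bullet> u"
    using u(1) by (simp add: scalar_prod_def power2_eq_square lessThan_atLeast0)
  finally have "b * (x \<bullet> x) \<le> (A *\<^sub>v u) \<bullet> (A *\<^sub>v u)" unfolding u(3) by simp
  then have "sqrt (b * (x \<bullet> x)) \<le> sqrt ((A *\<^sub>v u) \<bullet> (A *\<^sub>v u))" by (rule real_sqrt_le_mono)
  moreover have "(A * incl_mat m \<sigma>) *\<^sub>v x = A *\<^sub>v u"
    unfolding u_def using A I x by simp
  ultimately show "sqrt b * vnorm x \<le> vnorm ((A * incl_mat m \<sigma>) *\<^sub>v x)"
    by (simp add: vnorm_def real_sqrt_mult)
qed

text \<open>Traces and counts do not depend on the order, so they pass from the eigenvalues
  \<open>f\<close> to the decreasing list of singular values.\<close>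

lemma sum_lessThan_mset:
  assumes "mset xs = mset (map f [0..<m])"
  shows "(\<Sum>i<m. h (f i)) = (\<Sum>i<m. h (xs ! i) :: real)"
proof -
  have len: "length xs = m" using mset_eq_length[OF assms] by simp
  have "(\<Sum>i<m. h (f i)) = sum_list (map h (map f [0..<m]))"
    by (simp add: sum_list_sum_nth lessThan_atLeast0)
  also have "\<dots> = sum_list (map h xs)"
    by (metis assms mset_map sum_mset_sum_list)
  also have "\<dots> = (\<Sum>i<m. h (xs ! i))"
    using len by (simp add: sum_list_sum_nth lessThan_atLeast0)
  finally show ?thesis .
qed

text \<open>The initial data of the barrier argument: a negative shift adds \<open>\<beta>\<close>
  to the positive semidefinite Gram matrix, and the inverse is diagonalised by the same
  \<open>P\<close>.\<close>

lemma gram_shift_inverse: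
  fixes A :: "real mat"
  assumes A: "A \<in> carrier_mat n m" and \<beta>: "0 < \<beta>"
    and P: "P \<in> carrier_mat m m" "transpose_mat P * P = 1\<^sub>m m"
    and G: "transpose_mat A * A = P * mat_diag m (\<lambda>i. (f i)\<^sup>2) * transpose_mat P"
  shows "pos_def_on {..<m} (shift (\<lambda>i j. (transpose_mat A * A) $$ (i, j)) (- \<beta>))" (is "pos_def_on _ ?Y")
    and "\<exists>M. inverse_on {..<m} (shift (\<lambda>i j. (transpose_mat A * A) $$ (i, j)) (- \<beta>)) M \<and>
      (\<Sum>i<m. M i i) = (\<Sum>i<m. 1 / ((f i)\<^sup>2 + \<beta>))"
proof -
  let ?G = "transpose_mat A * A"
  define g where "g i = 1 / ((f i)\<^sup>2 + \<beta>)" for i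
  define N where "N = P * mat_diag m g * transpose_mat P"
  have N: "N \<in> carrier_mat m m" using P(1) by (simp add: N_def mult_carrier_mat[of _ m m])
  have PP: "(\<Sum>l<m. P $$ (i, l) * P $$ (j, l)) = (if i = j then 1 else 0)" if "i < m" "j < m" for i j
  proof -
    have "(P * transpose_mat P) $$ (i, j) = (\<Sum>l<m. P $$ (i, l) * P $$ (j, l))"
      using that P(1) by (simp add: scalar_prod_def lessThan_atLeast0)
    then show ?thesis unfolding orthogonal_mat_commute[OF P] using that by simp
  qed
  have G_sym: "?G $$ (i, j) = ?G $$ (j, i)" if "i < m" "j < m" for i j
    unfolding G orthogonal_diag_index[OF P(1) that] orthogonal_diag_index[OF P(1) that(2,1)]
    by (simp add: mult_ac)
  show "pos_def_on {..<m} ?Y"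
    unfolding pos_def_on_def
  proof (intro conjI allI impI)
    show "\<forall>i\<in>{..<m}. \<forall>j\<in>{..<m}. ?Y i j = ?Y j i"
      using G_sym by (auto simp: shift_def)
    fix x :: "nat \<Rightarrow> real" assume "\<exists>i\<in>{..<m}. x i \<noteq> 0"
    then obtain i where i: "i < m" "x i \<noteq> 0" by auto
    have "0 \<le> (\<Sum>i<m. \<Sum>j<m. x i * ?G $$ (i, j) * x j)"
      using gram_quad[OF A, of "vec m x" "{..<m}"] scalar_prod_self_nonneg[of "A *\<^sub>v vec m x"]
      by simp
    moreover have "0 < (\<Sum>i<m. (x i)\<^sup>2)"
      by (rule sum_pos2[of _ i]) (use i in auto)
    ultimately show "0 < (\<Sum>i<m. \<Sum>j<m. x i * ?Y i j * x j)"
      using \<beta> by (simp add: quad_shift add_nonneg_pos)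
  qed
  \<comment> \<open>On eigenvalues this is \<open>G N = 1 - \<beta> N\<close>, that is,
    \<open>(G + \<beta>) N = 1\<close>.\<close>
  have "(\<lambda>i. (f i)\<^sup>2 * g i) = (\<lambda>i. 1 - \<beta> * g i)"
  proof
    fix i
    have "(f i)\<^sup>2 + \<beta> > 0" using \<beta> by (simp add: add_nonneg_pos)
    then show "(f i)\<^sup>2 * g i = 1 - \<beta> * g i" by (simp add: g_def field_simps)
  qed
  then have GN: "?G * N = P * mat_diag m (\<lambda>i. 1 - \<beta> * g i) * transpose_mat P"
    unfolding G N_def orthogonal_diag_mult[OF P] by simp
  have "inverse_on {..<m} ?Y (\<lambda>i j. N $$ (i, j))"
    unfolding inverse_on_def
  proof (intro conjI ballI)
    fix i j assume "i \<in> {..<m}" "j \<in> {..<m}"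
    then have ij: "i < m" "j < m" by auto
    show "N $$ (i, j) = N $$ (j, i)"
      unfolding N_def orthogonal_diag_index[OF P(1) ij] orthogonal_diag_index[OF P(1) ij(2,1)]
      by (simp add: mult_ac)
    have "(\<Sum>l<m. ?Y i l * N $$ (l, j)) = (\<Sum>l<m. ?G $$ (i, l) * N $$ (l, j)) + \<beta> * N $$ (i, j)"
      using ij sum_shift[of "{..<m}" i "\<lambda>i j. ?G $$ (i, j)" "- \<beta>" "\<lambda>l. N $$ (l, j)"] by simp
    also have "(\<Sum>l<m. ?G $$ (i, l) * N $$ (l, j)) = (?G * N) $$ (i, j)"
      by (rule mult_mat_index[symmetric, OF _ N ij]) (use A in simp)
    also have "(?G * N) $$ (i, j) + \<beta> * N $$ (i, j) = (\<Sum>l<m. P $$ (i, l) * P $$ (j, l))"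
      unfolding GN unfolding N_def orthogonal_diag_index[OF P(1) ij] sum_distrib_left sum.distrib[symmetric]
      by (intro sum.cong refl) (simp add: algebra_simps)
    finally show "(\<Sum>l<m. ?Y i l * N $$ (l, j)) = (if i = j then 1 else 0)"
      unfolding PP[OF ij] .
  qed
  moreover have "(\<Sum>i<m. N $$ (i, i)) = (\<Sum>i<m. g i)"
  proof -
    have "(\<Sum>i<m. N $$ (i, i)) = (\<Sum>i<m. \<Sum>l<m. P $$ (i, l) * g l * P $$ (i, l))"
      by (intro sum.cong refl) (simp add: N_def orthogonal_diag_index[OF P(1)])
    also have "\<dots> = (\<Sum>l<m. \<Sum>i<m. P $$ (i, l) * g l * P $$ (i, l))" by (rule sum.swap)
    also have "\<dots> = (\<Sum>l<m. g l * (\<Sum>i<m. P $$ (i, l) * P $$ (i, l)))"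
      by (simp add: sum_distrib_left mult_ac)
    also have "\<dots> = (\<Sum>l<m. g l)"
    proof (intro sum.cong refl)
      fix l assume "l \<in> {..<m}"
      then have "(\<Sum>i<m. P $$ (i, l) * P $$ (i, l)) = (transpose_mat P * P) $$ (l, l)"
        using P(1) by (simp add: scalar_prod_def lessThan_atLeast0)
      then show "g l * (\<Sum>i<m. P $$ (i, l) * P $$ (i, l)) = g l"
        unfolding P(2) using \<open>l \<in> {..<m}\<close> by simp
    qed
    finally show ?thesis .
  qed
  ultimately show "\<exists>M. inverse_on {..<m} ?Y M \<and> (\<Sum>i<m. M i i) = (\<Sum>i<m. 1 / ((f i)\<^sup>2 + \<beta>))"
    unfolding g_def by blast
qed

lemma exists_subset_inverse_op_norm_le:
  fixes A :: "real mat"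
  assumes A: "A \<in> carrier_mat n m" and k: "1 \<le> k" "k < r" and r: "r \<le> vec_space.rank n A"
  shows "\<exists>\<sigma>\<subseteq>{..<m}. card \<sigma> = k \<and> inverse_op_norm (A * incl_mat m \<sigma>) \<le>
    ereal (2 * sqrt (real m * real r /
      ((real r - real k) * (\<Sum>i = r..m. (singular_value A i)\<^sup>2))))"
proof -
  obtain P f where P: "P \<in> carrier_mat m m" "transpose_mat P * P = 1\<^sub>m m"
    and f: "\<And>i. i < m \<Longrightarrow> 0 \<le> f i"
    and G: "transpose_mat A * A = P * mat_diag m (\<lambda>i. (f i)\<^sup>2) * transpose_mat P"
    and mset_f: "mset (singular_values A) = mset (map f [0..<m])"
    using gram_spectral_singular_values[OF A] by blast
  define xs where "xs = singular_values A"
  define y where "y i = (xs ! i)\<^sup>2" for i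
  have len: "length xs = m" using mset_eq_length[OF mset_f] by (simp add: xs_def)
  have nonneg: "0 \<le> xs ! i" if "i < m" for i
  proof -
    have "xs ! i \<in> set (map f [0..<m])"
      using that len mset_eq_setD[OF mset_f] nth_mem[of i xs] by (simp add: xs_def)
    then show ?thesis using f by auto
  qed
  have dec: "xs ! j \<le> xs ! i" if "i \<le> j" "j < m" for i j
    using that len sorted_rev_nth_mono[of xs i j]
    by (simp add: xs_def singular_values_def sorted_sorted_list_of_multiset)
  have y_dec: "y j \<le> y i" if "i \<le> j" "j < m" for i j
    unfolding y_def using that by (intro power_mono dec nonneg) auto
  have rank: "r \<le> card {i. i < m \<and> f i \<noteq> 0}"
    using r rank_le_nonzero_singular[OF A P G] by linarith
  have "card {i. i < m \<and> f i \<noteq> 0} = card {i. i < m \<and> xs ! i \<noteq> 0}"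
  proof -
    have "real (card {i. i < m \<and> h i \<noteq> 0}) = (\<Sum>i<m. if h i = 0 then 0 else 1)"
      for h :: "nat \<Rightarrow> real"
      by (simp add: sum.If_cases Int_def lessThan_def conj_commute)
    then show ?thesis
      using sum_lessThan_mset[OF mset_f, of "\<lambda>z. if z = 0 then 0 else 1"]
      unfolding xs_def by (metis of_nat_eq_iff)
  qed
  then have rank': "r \<le> card {i. i < m \<and> xs ! i \<noteq> 0}" using rank by simp
  also have "\<dots> \<le> card {..<m}" by (rule card_mono) auto
  finally have r_m: "r \<le> m" by simp
  \<comment> \<open>In a decreasing nonnegative list everything after a zero is zero, so a zero here
    would leave at most \<open>r - 1\<close> nonzero entries.\<close>
  have "xs ! (r - 1) \<noteq> 0"
  proof
    assume 0: "xs ! (r - 1) = 0"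
    have "{i. i < m \<and> xs ! i \<noteq> 0} \<subseteq> {..<r - 1}"
    proof (rule subsetI, rule ccontr)
      fix i assume i: "i \<in> {i. i < m \<and> xs ! i \<noteq> 0}" "i \<notin> {..<r - 1}"
      then have "xs ! i \<le> 0" using dec[of "r - 1" i] 0 by simp
      then show False using i(1) nonneg[of i] by simp
    qed
    then have "card {i. i < m \<and> xs ! i \<noteq> 0} \<le> r - 1"
      using card_mono[of "{..<r - 1}"] by fastforce
    then show False using rank' k by linarith
  qed
  then have pos: "0 < y (r - 1)" by (simp add: y_def)
  define T where "T = (\<Sum>i = r..m. (singular_value A i)\<^sup>2)"
  \<comment> \<open>Singular values are numbered from 1, the entries of \<open>y\<close> from
    0.\<close>
  have T: "T = (\<Sum>i\<in>{r - 1..<m}. y i)"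
    unfolding T_def y_def singular_value_def xs_def
    by (rule sum.reindex_bij_witness[of _ "\<lambda>i. i + 1" "\<lambda>i. i - 1"]) (use k r_m in auto)
  have "0 < T"
    unfolding T by (rule sum_pos2[of _ "r - 1"]) (use pos k r_m in \<open>auto simp: y_def\<close>)
  obtain \<beta> where \<beta>: "0 < \<beta>" "(real r - real k) * T / (4 * real m * real r)
      \<le> (real m - real k) / (\<Sum>i<m. 1 / (y i + \<beta>)) - \<beta>"
    using barrier_value[of m y k r, OF y_dec _ k(2) r_m pos] unfolding T by (auto simp: y_def)
  define \<phi> where "\<phi> = (\<Sum>i<m. 1 / (y i + \<beta>))"
  define b where "b = (real m - real k) / \<phi> - \<beta>"
  have "0 < \<phi>"
    unfolding \<phi>_def
    by (rule sum_pos) (use k r_m \<beta>(1) in \<open>auto simp: y_def add_nonneg_pos lessThan_empty_iff\<close>)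
  let ?G = "\<lambda>i j. (transpose_mat A * A) $$ (i, j)"
  obtain M where M: "inverse_on {..<m} (shift ?G (- \<beta>)) M"
    "(\<Sum>i<m. M i i) = (\<Sum>i<m. 1 / ((f i)\<^sup>2 + \<beta>))"
    using gram_shift_inverse(2)[OF A \<beta>(1) P G] by blast
  have tr: "(\<Sum>i<m. M i i) = \<phi>"
    unfolding M(2) \<phi>_def y_def xs_def by (rule sum_lessThan_mset[OF mset_f])
  \<comment> \<open>The initial trace is exactly \<open>\<phi>\<close>, so steps of length
    \<open>1 / \<phi>\<close> are allowed; \<open>m - k\<close> of them raise the barrier from
    \<open>- \<beta>\<close> to \<open>b\<close>.\<close>
  have "\<exists>\<sigma>\<subseteq>{..<m}. card \<sigma> = k \<and>
      pos_def_on \<sigma> (shift (shift ?G (- \<beta>)) (real (card {..<m} - k) * (1 / \<phi>)))"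
    by (rule barrier_subset[OF _ gram_shift_inverse(1)[OF A \<beta>(1) P G] M(1)])
      (use \<open>0 < \<phi>\<close> tr k r_m in auto)
  moreover have "- \<beta> + real (card {..<m} - k) * (1 / \<phi>) = b"
    using k r_m by (simp add: b_def of_nat_diff)
  ultimately obtain \<sigma> where \<sigma>: "\<sigma> \<subseteq> {..<m}" "card \<sigma> = k" "pos_def_on \<sigma> (shift ?G b)"
    unfolding shift_shift by auto
  \<comment> \<open>\<open>1 / c\<close> is four times the quantity under the root in the claim,
    whence the factor 2.\<close>
  define c where "c = (real r - real k) * T / (4 * real m * real r)"
  have c: "0 < c" "c \<le> b"
    using k r_m \<open>0 < T\<close> \<beta>(2) by (simp_all add: c_def b_def \<phi>_def)
  have "inverse_op_norm (A * incl_mat m \<sigma>) \<le> ereal (1 / sqrt b)"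
    by (rule inverse_op_norm_gram_le[OF A \<sigma>(1) _ \<sigma>(3)]) (use c in simp)
  also have "\<dots> \<le> ereal (1 / sqrt c)"
    using c by (simp add: frac_le)
  also have "1 / sqrt c = sqrt (1 / c)" by (simp add: real_sqrt_divide)
  also have "1 / c = 4 * (real m * real r / ((real r - real k) * T))" by (simp add: c_def)
  also have "sqrt \<dots> = 2 * sqrt (real m * real r / ((real r - real k) * T))"
    unfolding real_sqrt_mult by simp
  finally show ?thesis using \<sigma> unfolding T_def by blast
qed

theorem theorem6:
  shows "\<exists>C::real. 0 < C \<and>
    (\<forall>(k::nat) (m::nat) (n::nat) (A::real mat).
      1 \<le> k \<longrightarrow> 1 \<le> m \<longrightarrow> 1 \<le> n \<longrightarrow> A \<in> carrier_mat n m \<longrightarrow> vec_space.rank n A > k \<longrightarrow>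
      (\<exists>\<sigma>. \<sigma> \<subseteq> {..<m} \<and> card \<sigma> = k \<and>
        inverse_op_norm (A * incl_mat m \<sigma>) \<le>
          ereal (C * (MIN r\<in>{k + 1..vec_space.rank n A}.
            sqrt (real m * real r /
              ((real r - real k) * (\<Sum>i = r..m. (singular_value A i)\<^sup>2)))))))"
proof (intro exI[of _ "2 :: real"] conjI allI impI)
  fix k m n :: nat and A :: "real mat"
  assume k: "1 \<le> k" and A: "A \<in> carrier_mat n m" and rank: "k < vec_space.rank n A"
  let ?R = "{k + 1..vec_space.rank n A}"
  let ?q = "\<lambda>r. sqrt (real m * real r /
    ((real r - real k) * (\<Sum>i = r..m. (singular_value A i)\<^sup>2)))"
  \<comment> \<open>In the bound for a fixed \<open>r\<close> the set \<open>\<sigma>\<close> may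
    depend on \<open>r\<close>, so that bound is applied at an \<open>r\<close> attaining the
    minimum.\<close>
  have "Min (?q ` ?R) \<in> ?q ` ?R" using rank by (intro Min_in) auto
  then obtain r where r: "r \<in> ?R" "Min (?q ` ?R) = ?q r" by blast
  show "\<exists>\<sigma>. \<sigma> \<subseteq> {..<m} \<and> card \<sigma> = k \<and>
      inverse_op_norm (A * incl_mat m \<sigma>) \<le> ereal (2 * Min (?q ` ?R))"
    unfolding r(2) by (rule exists_subset_inverse_op_norm_le[OF A k]) (use r(1) in simp_all)
qed simp

end
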